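(* Let $N\in\mathbb{N}$, let $I$ be a non-empty set, let $\mathfrak{d}=(\mathfrak{d}_1,\ldots,\mathfrak{d}_N)\colon I\to\mathbb{N}^N$ be an $N$-fold dimension mapping on $I$, let $c,T,r_0,r_1,\ldots,r_N,\alpha_1,\ldots,\alpha_N,\beta_1,\ldots,\beta_N,\iota_1,\ldots,\iota_N,R_0,R_1,\ldots,R_N\in[0,\infty)$, $\rho\in[0,1)$, $\kappa\in[1,\infty)$, $H=(H_{i,\varepsilon})_{(i,\varepsilon)\in I\times(0,1]}\subseteq(0,\infty]$, $a\in C(\mathbb{R},\mathbb{R})$, $(\mathfrak{i}_d)_{d\in\mathbb{N}}\subseteq\mathbb{N}$, $(\Psi_d)_{d\in\mathbb{N}}\subseteq\mathscr{N}$ satisfy for all $k\in\{1,\ldots,N\}$, $d\in\mathbb{N}$ that $$R_0=1+\tfrac{2r_0(\kappa+2)}{1-\rho},\qquad R_k=\alpha_k+2r_k+8\iota_k+\tfrac{2r_0(\alpha_k(\kappa+1)+\beta_k)}{1-\rho},$$ $\mathcal{R}_a(\Psi_d)=\mathrm{id}_{\mathbb{R}^d}$, $\mathcal{D}(\Psi_d)=(d,\mathfrak{i}_d,d)$, and $\mathfrak{i}_d\le cd$. Let $\mathfrak{I}\colon I\to\mathbb{N}$ and $\mathfrak{w}\colon[0,\infty)\to[0,\infty)$ satisfy for all $v\in[0,\infty)$ that $\mathfrak{w}(v)=(1+v^\kappa)^{-1}$. Let $f=(f_i)_{i\in I}\in\mathcal{W}_{a,\mathfrak{w},c,H}^{r_0,r_1,\ldots,r_N}(I,\mathfrak{d})$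 and $g=(g_i)_{i\in I}\in\mathcal{W}_{a,\mathfrak{w},\infty,\infty}^{r_0,r_1,\ldots,r_N}(I,\mathfrak{d})$, and assume for all $i\in I$, $x,y\in\mathbb{R}^{\mathfrak{I}(i)}$ that $f_i\in C(\mathbb{R}^{\mathfrak{I}(i)},\mathbb{R}^{\mathfrak{I}(i)})$, $g_i\in C(\mathbb{R}^{\mathfrak{I}(i)},\mathbb{R})$, $\max\{\|f_i(x)-f_i(y)\|,|g_i(x)-g_i(y)|\}\le c\|x-y\|$, and $$\sup_{j\in I}\sup_{\varepsilon\in(0,1]}\left(\frac{|H_{j,\varepsilon}|^\kappa}{\varepsilon^{-\rho}\prod_{l=1}^N|\mathfrak{d}_l(j)|^{\beta_l}}+\frac{\|f_j(0)\|}{\prod_{l=1}^N|\mathfrak{d}_l(j)|^{\alpha_l}}+\frac{\mathfrak{I}(j)}{\prod_{l=1}^N|\mathfrak{d}_l(j)|^{\iota_l}}\right)<\infty.$$ Then $(g\star_T f)\in\mathcal{W}_{a,\mathfrak{w},\infty,\infty}^{R_0,R_1,\ldots,R_N}(I,\mathfrak{d})$.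
   Context: $\mathbb{N}=\{1,2,3,\ldots\}$ and $\|\cdot\|$ is the Euclidean norm on every $\mathbb{R}^d$. ANNs: $\mathscr{N} = \bigcup_{L\in\mathbb{N}}\bigcup_{l_0,\ldots,l_L\in\mathbb{N}} \left(\times_{k=1}^L (\mathbb{R}^{l_k\times l_{k-1}}\times\mathbb{R}^{l_k})\right)$. For $\Phi=((W_1,B_1),\ldots,(W_L,B_L)) \in \times_{k=1}^L (\mathbb{R}^{l_k\times l_{k-1}}\times\mathbb{R}^{l_k})$: $\mathcal{D}(\Phi)=(l_0,l_1,\ldots,l_L)$, $\mathcal{P}(\Phi)=\sum_{k=1}^L l_k(l_{k-1}+1)$, and for $a\in C(\mathbb{R},\mathbb{R})$ the realization $\mathcal{R}_a(\Phi)\in C(\mathbb{R}^{l_0},\mathbb{R}^{l_L})$ is $(\mathcal{R}_a(\Phi))(x_0)=W_Lx_{L-1}+B_L$, where for $0<k<L$ the vector $x_k$ is obtained by applying $a$ componentwise to $W_kx_{k-1}+B_k$. A function family on a non-empty set $I$ is a map $f=(f_i)_{i\in I}\colon I\to\bigcup_{k,l\in\mathbb{N}}C(\mathbb{R}^k,\mathbb{R}^l)$. An $N$-fold dimension mapping on $I$ is a function $\mathfrak{d}=(\mathfrak{d}_1,\ldots,\mathfrak{d}_N)\colon I\to\mathbb{N}^N$. Approximation spaces: for an $N$-fold dimension mapping $\mathfrak{d}$ on $I$, $r_0,\ldots,r_N\in\mathbb{R}$, $a\in C(\mathbb{R},\mathbb{R})$, $G=(G_{i,\varepsilon})_{(i,\varepsilon)\in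 I\times(0,1]}\subseteq(0,\infty]$, $H=(H_{i,\varepsilon})_{(i,\varepsilon)\in I\times(0,1]}\subseteq(0,\infty]$, and $\mathfrak{w}\colon[0,\infty)\to[0,\infty)$, the set $\mathcal{W}_{a,\mathfrak{w},G,H}^{r_0,r_1,\ldots,r_N}(I,\mathfrak{d})$ consists of all function families $f=(f_i)_{i\in I}$ on $I$ for which there exists $K\in\mathbb{R}$ such that for all $i\in I$, $\varepsilon\in(0,1]$ there exist $\Phi\in\mathscr{N}$ and $m,n\in\mathbb{N}$ such that for all $x\in\mathbb{R}^m$: $\{f_i,\mathcal{R}_a(\Phi)\}\subseteq C(\mathbb{R}^m,\mathbb{R}^n)$, $\mathcal{P}(\Phi)\le K\varepsilon^{-r_0}\prod_{l=1}^N|\mathfrak{d}_l(i)|^{r_l}$, $\mathfrak{w}(\|x\|)\|f_i(x)-(\mathcal{R}_a(\Phi))(x)\|\le\varepsilon$, and $\|(\mathcal{R}_a(\Phi))(x)\|\le G_{i,\varepsilon}(H_{i,\varepsilon}+\|x\|)$. A constant in place of $G$ or $H$ denotes the corresponding constant family; in particular in $\mathcal{W}_{a,\mathfrak{w},\infty,\infty}^{\ldots}$ the last condition is vacuous, and in $\mathcal{W}_{a,\mathfrak{w},c,H}^{\ldots}$ one has $G_{i,\varepsilon}=c$ for all $i,\varepsilon$ (in the claim $1\le\mathfrak{i}_1\le c$, so $c>0$). Flow operation: if $f_i\colon\mathbb{R}^{\mathfrak{I}(i)}\to\mathbb{R}^{\mathfrak{I}(i)}$ is locally Lipschitz continuous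 with $\sup_x\frac{\|f_i(x)\|}{1+\|x\|}<\infty$ and $g_i\in C(\mathbb{R}^{\mathfrak{I}(i)},\mathbb{R})$ for all $i\in I$, then $g\star_Tf$ is the function family on $I$ given by $(g\star_Tf)_i(x)=g_i(X_T^{i,x})$ for $i\in I$, $x\in\mathbb{R}^{\mathfrak{I}(i)}$, where $X^{i,x}\in C([0,T],\mathbb{R}^{\mathfrak{I}(i)})$ is the unique solution of $X^{i,x}_t=x+\int_0^tf_i(X^{i,x}_s)\,ds$, $t\in[0,T]$. *)

theory Defs
  imports
    "HOL-Analysis.Analysis"
    "Jordan_Normal_Form.Matrix"
begin

section \<open>Euclidean spaces of varying dimension\<close>

text \<open>
  The dimensions vary with the index of a function family, so the vectors of R^n are the elements
  of \<^term>\<open>carrier_vec n\<close>. The Euclidean norm on them induces the topology.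
\<close>

definition vnorm :: "real Matrix.vec \<Rightarrow> real" where
  "vnorm x = L2_set (vec_index x) {..<dim_vec x}"

text \<open>
  On \<^term>\<open>carrier_vec n\<close> this is the norm of the difference. It is written out because a metric
  has to be symmetric for all elements of the type, which \<open>vnorm (x - y)\<close> is not when the
  dimensions of \<open>x\<close> and \<open>y\<close> differ.
\<close>

definition vdist :: "nat \<Rightarrow> real Matrix.vec \<Rightarrow> real Matrix.vec \<Rightarrow> real" where
  "vdist n x y = L2_set (\<lambda>i. vec_index x i - vec_index y i) {..<n}"

definition Rn :: "nat \<Rightarrow> real Matrix.vec topology" where
  "Rn n = Metric_space.mtopology (carrier_vec n) (vdist n)"

lemma vdist_eq_vnorm:
  assumes "x \<in> carrier_vec n" "y \<in> carrier_vec n"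
  shows "vdist n x y = vnorm (x - y)"
  using assms unfolding vdist_def vnorm_def by (intro L2_set_cong) auto

lemma Metric_space_vdist: "Metric_space (carrier_vec n) (vdist n)"
proof
  fix x y z :: "real Matrix.vec"
  show "0 \<le> vdist n x y"
    by (simp add: vdist_def L2_set_nonneg)
  show "vdist n x y = vdist n y x"
    by (simp add: vdist_def L2_set_def power2_commute)
  show "vdist n x y = 0 \<longleftrightarrow> x = y" if "x \<in> carrier_vec n" "y \<in> carrier_vec n"
    using that by (auto simp: vdist_def L2_set_eq_0_iff)
  have "vdist n x z = L2_set (\<lambda>i. (vec_index x i - vec_index y i)
      + (vec_index y i - vec_index z i)) {..<n}"
    by (simp add: vdist_def)
  also have "\<dots> \<le> vdist n x y + vdist n y z"
    unfolding vdist_def by (rule L2_set_triangle_ineq)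
  finally show "vdist n x z \<le> vdist n x y + vdist n y z" .
qed

text \<open>
  Functions between Euclidean spaces are partial functions, so that a function determines its
  domain; since vectors carry their dimension, an element of \<open>C_fun m n\<close> with \<open>m, n \<ge> 1\<close>
  determines \<open>m\<close> and \<open>n\<close>.
\<close>

type_synonym vfun = "real Matrix.vec \<rightharpoonup> real Matrix.vec"

definition C_fun :: "nat \<Rightarrow> nat \<Rightarrow> vfun set" where
  "C_fun m n = {F. dom F = carrier_vec m \<and> continuous_map (Rn m) (Rn n) (\<lambda>x. the (F x))}"

section \<open>Artificial neural networks\<close>

type_synonym ann = "(real mat \<times> real Matrix.vec) list"

text \<open>
  In the list \<open>ls\<close> of layer widths \<open>l_0, ..., l_L\<close>, the entry \<open>ls ! k\<close> is \<open>l_k\<close>, while the pair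
  \<open>\<Phi> ! k\<close> is \<open>(W_{k+1}, B_{k+1})\<close>.
\<close>

definition ANNs :: "ann set" where
  "ANNs = (\<Union>L\<in>{1..}. \<Union>ls\<in>{ls. length ls = Suc L \<and> (\<forall>l\<in>set ls. 1 \<le> l)}.
     {\<Phi>. length \<Phi> = L \<and>
         (\<forall>k<L. fst (\<Phi> ! k) \<in> carrier_mat (ls ! Suc k) (ls ! k) \<and>
                snd (\<Phi> ! k) \<in> carrier_vec (ls ! Suc k))})"

definition layer_dims :: "ann \<Rightarrow> nat list" where
  "layer_dims \<Phi> = dim_col (fst (hd \<Phi>)) # map (\<lambda>(W, B). dim_row W) \<Phi>"

definition num_params :: "ann \<Rightarrow> nat" where
  "num_params \<Phi> =
     (\<Sum>k = 1..length \<Phi>. layer_dims \<Phi> ! k * (layer_dims \<Phi> ! (k - 1) + 1))"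

fun net_eval :: "(real \<Rightarrow> real) \<Rightarrow> ann \<Rightarrow> real Matrix.vec \<Rightarrow> real Matrix.vec" where
  "net_eval a [] x = x"
| "net_eval a [(W, B)] x = W *\<^sub>v x + B"
| "net_eval a ((W, B) # L # \<Phi>) x = net_eval a (L # \<Phi>) (map_vec a (W *\<^sub>v x + B))"

definition realization :: "(real \<Rightarrow> real) \<Rightarrow> ann \<Rightarrow> vfun" where
  "realization a \<Phi> =
     (\<lambda>x. if x \<in> carrier_vec (hd (layer_dims \<Phi>)) then Some (net_eval a \<Phi> x) else None)"

section \<open>Function families and approximation spaces\<close>

definition function_families :: "'i set \<Rightarrow> ('i \<Rightarrow> vfun) set" where
  "function_families I = {f. \<forall>i\<in>I. f i \<in> (\<Union>k\<in>{1..}. \<Union>l\<in>{1..}. C_fun k l)}"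

text \<open>The \<open>l\<close>-th component \<open>\<dd>_l(i)\<close> of a dimension mapping is \<open>\<dd> i l\<close>.\<close>

definition dimension_mapping :: "nat \<Rightarrow> 'i set \<Rightarrow> ('i \<Rightarrow> nat \<Rightarrow> nat) \<Rightarrow> bool" where
  "dimension_mapping N I \<dd> \<longleftrightarrow> (\<forall>i\<in>I. \<forall>l\<in>{1..N}. 1 \<le> \<dd> i l)"

text \<open>\<open>G\<close> and \<open>H\<close> are meant to take values in \<open>(0, \<infinity>]\<close>.\<close>

definition approx_space ::
  "nat \<Rightarrow> (nat \<Rightarrow> real) \<Rightarrow> (real \<Rightarrow> real) \<Rightarrow> (real \<Rightarrow> real) \<Rightarrow>
   ('i \<Rightarrow> real \<Rightarrow> ereal) \<Rightarrow> ('i \<Rightarrow> real \<Rightarrow> ereal) \<Rightarrow>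
   'i set \<Rightarrow> ('i \<Rightarrow> nat \<Rightarrow> nat) \<Rightarrow> ('i \<Rightarrow> vfun) set" where
  "approx_space N r a w G H I \<dd> =
     {f \<in> function_families I.
        \<exists>K::real. \<forall>i\<in>I. \<forall>\<epsilon>\<in>{0<..1}.
          \<exists>\<Phi>\<in>ANNs. \<exists>m\<ge>1. \<exists>n\<ge>1. \<forall>x\<in>carrier_vec m.
            {f i, realization a \<Phi>} \<subseteq> C_fun m n \<and>
            real (num_params \<Phi>) \<le> K * \<epsilon> powr (- r 0) * (\<Prod>l = 1..N. real (\<dd> i l) powr r l) \<and>
            w (vnorm x) * vnorm (the (f i x) - the (realization a \<Phi> x)) \<le> \<epsilon> \<and>
            ereal (vnorm (the (realization a \<Phi> x))) \<le> G i \<epsilon> * (H i \<epsilon> + ereal (vnorm x))}"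

section \<open>The flow operation\<close>

text \<open>
  \<open>X\<close> is a continuous solution on \<open>[0, T]\<close> of \<open>X t = x + integral of F (X s) over [0, t]\<close>
  in \<open>R^d\<close>; the integral is taken componentwise.
\<close>

definition flow_solution ::
  "real \<Rightarrow> nat \<Rightarrow> vfun \<Rightarrow> real Matrix.vec \<Rightarrow> (real \<Rightarrow> real Matrix.vec) \<Rightarrow> bool" where
  "flow_solution T d F x X \<longleftrightarrow>
     continuous_map (top_of_set {0..T}) (Rn d) X \<and>
     (\<forall>t\<in>{0..T}. X t =
        x + Matrix.vec d (\<lambda>j. integral {0..t} (\<lambda>s. vec_index (the (F (X s))) j)))"

text \<open>
  Solutions are unique only as functions on \<open>[0, T]\<close>, but \<open>X\<close> is total; hence the
  description operator is applied to the terminal value \<open>X T\<close> rather than to \<open>X\<close>.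
\<close>

definition flow_value :: "real \<Rightarrow> nat \<Rightarrow> vfun \<Rightarrow> real Matrix.vec \<Rightarrow> real Matrix.vec" where
  "flow_value T d F x = (THE y. \<exists>X. flow_solution T d F x X \<and> y = X T)"

text \<open>
  Here \<open>f i\<close> maps \<open>R^(\<II> i)\<close> to itself and \<open>g i\<close> maps \<open>R^(\<II> i)\<close> to \<open>R\<close>; \<open>f i\<close> is assumed locally
  Lipschitz of at most linear growth, so that the flow exists and is unique.
\<close>

definition flow_op ::
  "real \<Rightarrow> ('i \<Rightarrow> nat) \<Rightarrow> ('i \<Rightarrow> vfun) \<Rightarrow> ('i \<Rightarrow> vfun) \<Rightarrow> 'i \<Rightarrow> vfun" where
  "flow_op T \<II> g f i =
     (\<lambda>x. if x \<in> carrier_vec (\<II> i) then g i (flow_value T (\<II> i) (f i) x) else None)"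

section \<open>Real powers of elements of the extended half-line\<close>

text \<open>Only used for \<open>h \<ge> 0\<close> and \<open>p > 0\<close>, where the power of \<open>\<infinity>\<close> is \<open>\<infinity>\<close>.\<close>

definition ereal_powr :: "ereal \<Rightarrow> real \<Rightarrow> ereal" where
  "ereal_powr h p = (if h = \<infinity> then \<infinity> else ereal (real_of_ereal h powr p))"

end

theory Submission
  imports Defs "HOL-Probability.Discrete_Topology"
begin

text \<open>
  The flow is approximated by \<open>n\<close> Euler steps \<open>y \<mapsto> y + (T/n) \<phi> y\<close>, where \<open>\<phi>\<close> is a network close
  to \<open>f i\<close>. Running the identity network in parallel with \<open>\<phi>\<close> turns one step into a network, and
  merging adjacent affine layers composes \<open>n\<close> such networks with one for \<open>g i\<close> at a cost that is
  linear in \<open>n\<close> and quadratic in the size of a single network. The Euler error is of order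
  \<open>D^\<alpha>/n\<close>, while the bound \<open>c (H + \<parallel>x\<parallel>)\<close> for \<open>\<phi>\<close> shows that networks of accuracy \<open>\<delta>\<close> contribute an
  error of order \<open>\<delta> H^\<kappa>\<close>, that is \<open>\<delta>^(1-\<rho>) D^\<beta>\<close>. Balancing both with \<open>\<epsilon>\<close> leads to
  \<open>n \<approx> D^\<alpha>/\<epsilon>\<close> and \<open>\<delta> \<approx> (\<epsilon>/D^\<beta>)^(1/(1-\<rho>))\<close>; here \<open>D^s\<close> is the product of the \<open>\<dd>_l(i)^(s_l)\<close>.
\<close>

unbundle no vec_syntax

section \<open>The topology and the norm of Euclidean spaces\<close>

text \<open>The weight controls a network for \<open>f i\<close> only up to
  \<open>\<delta> * (1 + vnorm y powr \<kappa>)\<close>; for \<kappa> > 1 this alone would let Euler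
  iterates driven by the network grow superlinearly. The linear bound on the network itself keeps
  all iterates in a ball of radius exp(c T) (|x| + H), whatever the number of steps. As H belongs to
  the accuracy \<delta> in use, its \<kappa>-th power costs \<delta>^(-\<rho>), and \<rho> < 1
  leaves a positive power of \<delta>. The factor D^\<alpha> in n comes from |f i 0|, which enters
  the speed of the flow. The size needs similar care. Merging two affine layers yields a matrix
  whose size is a product of widths, so repeated composition might compound. It does not, because
  each step is put in front of the network built so far, and the number of rows of the first layer
  of that network stays below a fixed bound. The identity network enlarges a step by a factor (1 +
  i)^2, hence (1 + i)^4 after squaring, which is where the powers of D^\<iota> come from.\<close>

lemma topspace_Rn [simp]: "topspace (Rn n) = carrier_vec n"
  unfolding Rn_def by (rule Metric_space.topspace_mtopology[OF Metric_space_vdist])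

lemma continuous_map_Rn_index:
  assumes "j < n"
  shows "continuous_map (Rn n) euclideanreal (\<lambda>x. x $ j)"
proof -
  interpret M: Metric_space "carrier_vec n" "vdist n" by (rule Metric_space_vdist)
  show ?thesis
    unfolding Rn_def M.continuous_map_from_metric
  proof (intro conjI ballI allI impI)
    fix x U assume x: "x \<in> carrier_vec n" and U: "openin euclideanreal U \<and> x $ j \<in> U"
    then obtain e where e: "e > 0" "ball (x $ j) e \<subseteq> U"
      by (metis open_contains_ball open_openin)
    have "\<bar>x $ j - y $ j\<bar> \<le> vdist n x y" for y
      using member_le_L2_set[of "{..<n}" j "\<lambda>i. \<bar>x $ i - y $ i\<bar>"] assms
      by (simp add: vdist_def L2_set_def)
    then show "\<exists>r>0. \<forall>y. y \<in> carrier_vec n \<and> vdist n x y < r \<longrightarrow> y $ j \<in> U"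
      using e by (intro exI[of _ e]) (auto simp: dist_real_def subset_iff intro: le_less_trans)
  qed auto
qed

text \<open>The distance is a continuous function of finitely many coordinates, so the Euclidean
  metric induces the product topology. All later continuity proofs are thereby reduced to
  real-valued functions.\<close>

lemma continuous_map_Rn_iff:
  "continuous_map X (Rn n) F \<longleftrightarrow>
     (\<forall>x\<in>topspace X. F x \<in> carrier_vec n) \<and>
     (\<forall>j<n. continuous_map X euclideanreal (\<lambda>x. F x $ j))"
proof (intro iffI conjI; (elim conjE)?)
  assume F: "continuous_map X (Rn n) F"
  show "\<forall>x\<in>topspace X. F x \<in> carrier_vec n"
    using continuous_map_image_subset_topspace[OF F] by auto
  show "\<forall>j<n. continuous_map X euclideanreal (\<lambda>x. F x $ j)"
    using continuous_map_compose[OF F continuous_map_Rn_index] by (simp add: comp_def)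
next
  assume F: "\<forall>x\<in>topspace X. F x \<in> carrier_vec n"
    and cont: "\<forall>j<n. continuous_map X euclideanreal (\<lambda>x. F x $ j)"
  interpret M: Metric_space "carrier_vec n" "vdist n" by (rule Metric_space_vdist)
  show "continuous_map X (Rn n) F"
    unfolding Rn_def M.continuous_map_to_metric
  proof (intro ballI allI impI)
    fix x and \<epsilon> :: real assume x: "x \<in> topspace X" and "\<epsilon> > 0"
    have "continuous_map X euclideanreal (\<lambda>y. vdist n (F x) (F y))"
      unfolding vdist_def L2_set_def using cont
      by (intro continuous_map_sqrt continuous_map_sum continuous_map_real_pow
          continuous_map_diff) auto
    then have "openin X {y \<in> topspace X. vdist n (F x) (F y) \<in> {..<\<epsilon>}}"
      by (rule openin_continuous_map_preimage) auto
    moreover have "vdist n (F x) (F x) = 0"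
      using F x by simp
    ultimately show "\<exists>U. openin X U \<and> x \<in> U \<and> (\<forall>y\<in>U. F y \<in> M.mball (F x) \<epsilon>)"
      using F x \<open>\<epsilon> > 0\<close>
      by (intro exI[of _ "{y \<in> topspace X. vdist n (F x) (F y) \<in> {..<\<epsilon>}}"]) auto
  qed
qed

lemma C_fun_iff:
  "F \<in> C_fun m n \<longleftrightarrow> dom F = carrier_vec m \<and> continuous_map (Rn m) (Rn n) (\<lambda>x. the (F x))"
  by (simp add: C_fun_def)

lemma C_fun_carrier:
  assumes "F \<in> C_fun m n" "x \<in> carrier_vec m"
  shows "the (F x) \<in> carrier_vec n"
  using assms by (simp add: C_fun_iff continuous_map_Rn_iff)

lemma carrier_vec_inject: "(carrier_vec m :: ('a :: zero) Matrix.vec set) = carrier_vec n \<longleftrightarrow> m = n"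
proof
  assume "(carrier_vec m :: 'a Matrix.vec set) = carrier_vec n"
  then have "(0\<^sub>v m :: 'a Matrix.vec) \<in> carrier_vec n"
    using zero_carrier_vec by blast
  from carrier_vecD[OF this] show "m = n" by (simp only: index_zero_vec)
qed simp

text \<open>The domain fixes \<open>m\<close>, and the value at \<open>0\<^sub>v m\<close> fixes
  \<open>n\<close>, since vectors carry their dimension. This pins down the existentially quantified
  dimensions in \<open>approx_space\<close>.\<close>

lemma C_fun_unique_dims:
  assumes "F \<in> C_fun m n" "F \<in> C_fun m' n'"
  shows "m = m'" "n = n'"
proof -
  show m: "m = m'"
    using assms by (simp add: C_fun_iff carrier_vec_inject)
  show "n = n'"
    using C_fun_carrier[OF assms(1), of "0\<^sub>v m"] C_fun_carrier[OF assms(2), of "0\<^sub>v m"] m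
    by (auto dest: carrier_vecD)
qed

section \<open>The Euclidean norm on vectors of a fixed dimension\<close>

lemma vnorm_eq_L2_set: "x \<in> carrier_vec n \<Longrightarrow> vnorm x = L2_set (vec_index x) {..<n}"
  by (auto simp: vnorm_def)

lemma vnorm_nonneg [simp]: "0 \<le> vnorm x"
  by (simp add: vnorm_def L2_set_nonneg)

lemma vnorm_zero [simp]: "vnorm (0\<^sub>v n) = 0"
  by (simp add: vnorm_def L2_set_eq_0_iff)

lemma vnorm_add_le:
  assumes "x \<in> carrier_vec n" "y \<in> carrier_vec n"
  shows "vnorm (x + y) \<le> vnorm x + vnorm y"
proof -
  have "vnorm (x + y) = L2_set (\<lambda>i. x $ i + y $ i) {..<n}"
    using assms by (auto simp: vnorm_def intro!: L2_set_cong)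
  then show ?thesis
    using L2_set_triangle_ineq[of "vec_index x" "vec_index y" "{..<n}"] assms
    by (simp add: vnorm_eq_L2_set)
qed

lemma vnorm_smult: "vnorm (t \<cdot>\<^sub>v x) = \<bar>t\<bar> * vnorm x"
proof -
  have "vnorm (t \<cdot>\<^sub>v x) = L2_set (\<lambda>i. t * x $ i) {..<dim_vec x}"
    by (auto simp: vnorm_def intro!: L2_set_cong)
  also have "\<dots> = \<bar>t\<bar> * vnorm x"
    by (simp add: vnorm_def L2_set_def power_mult_distrib real_sqrt_mult flip: sum_distrib_left)
  finally show ?thesis .
qed

lemma vnorm_triangle:
  assumes "x \<in> carrier_vec n" "y \<in> carrier_vec n" "z \<in> carrier_vec n"
  shows "vnorm (x - z) \<le> vnorm (x - y) + vnorm (y - z)"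
proof -
  have "x - z = (x - y) + (y - z)"
    using assms by (intro eq_vecI) auto
  then show ?thesis
    using vnorm_add_le[of "x - y" n "y - z"] assms by simp
qed

lemma vnorm_le_add_diff:
  assumes "x \<in> carrier_vec n" "y \<in> carrier_vec n"
  shows "vnorm x \<le> vnorm y + vnorm (x - y)"
proof -
  have "x = y + (x - y)"
    using assms by (intro eq_vecI) auto
  then show ?thesis
    using vnorm_add_le[of y n "x - y"] assms by simp
qed

lemma vnorm_zero_imp_eq:
  assumes "x \<in> carrier_vec n" "y \<in> carrier_vec n" "vnorm (x - y) \<le> 0"
  shows "x = y"
proof -
  have "vnorm (x - y) = 0"
    using assms(3) vnorm_nonneg[of "x - y"] by linarith
  then have "vdist n x y = 0"
    using assms by (simp add: vdist_eq_vnorm)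
  then show ?thesis
    using Metric_space.zero[OF Metric_space_vdist] assms by blast
qed

lemma abs_index_le_vnorm:
  assumes "x \<in> carrier_vec n" "j < n"
  shows "\<bar>x $ j\<bar> \<le> vnorm x"
  using member_le_L2_set[of "{..<n}" j "\<lambda>i. \<bar>x $ i\<bar>"] assms
  by (auto simp: vnorm_def L2_set_def)

lemma vnorm_le_sum_abs: "x \<in> carrier_vec n \<Longrightarrow> vnorm x \<le> (\<Sum>k<n. \<bar>x $ k\<bar>)"
  unfolding vnorm_eq_L2_set[of x n] by (rule L2_set_le_sum_abs)

section \<open>Networks as lists of layers\<close>

text \<open>\<open>ANNs\<close> describes the chaining of layers by indices into a list of widths; a
  recursion on the layers makes it accessible to induction. The empty list is only the base case,
  with equal dimensions; it is not in \<open>ANNs\<close>, hence the recurring side condition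
  \<open>\<Phi> \<noteq> []\<close>.\<close>

fun is_net :: "nat \<Rightarrow> nat \<Rightarrow> ann \<Rightarrow> bool" where
  "is_net m n [] \<longleftrightarrow> m = n \<and> 1 \<le> n"
| "is_net m n ((W, B) # \<Phi>) \<longleftrightarrow> 1 \<le> m \<and> dim_col W = m \<and>
     dim_vec B = dim_row W \<and> is_net (dim_row W) n \<Phi>"

fun net_size :: "ann \<Rightarrow> nat" where
  "net_size [] = 0"
| "net_size ((W, B) # \<Phi>) = dim_row W * (dim_col W + 1) + net_size \<Phi>"

lemma is_net_pos:
  assumes "is_net m n \<Phi>"
  shows "1 \<le> m" "1 \<le> n"
  using assms by (induction m n \<Phi> rule: is_net.induct) auto

lemma net_eval_Cons:
  "\<Phi> \<noteq> [] \<Longrightarrow> net_eval a ((W, B) # \<Phi>) x = net_eval a \<Phi> (map_vec a (W *\<^sub>v x + B))"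
  by (cases \<Phi>) auto

lemma is_net_of_layers:
  assumes "length ls = Suc (length \<Phi>)" "\<forall>l\<in>set ls. 1 \<le> l"
    "\<forall>k<length \<Phi>. fst (\<Phi> ! k) \<in> carrier_mat (ls ! Suc k) (ls ! k) \<and>
       snd (\<Phi> ! k) \<in> carrier_vec (ls ! Suc k)"
  shows "is_net (hd ls) (last ls) \<Phi>"
  using assms
proof (induction \<Phi> arbitrary: ls)
  case Nil
  then obtain l where "ls = [l]" by (auto simp: length_Suc_conv)
  with Nil show ?case by simp
next
  case (Cons L \<Phi>)
  obtain W B where L: "L = (W, B)" by fastforce
  from Cons.prems obtain l ls' where ls: "ls = l # ls'" "length ls' = Suc (length \<Phi>)"
    by (auto simp: length_Suc_conv)
  then obtain l' ls'' where ls': "ls' = l' # ls''" by (auto simp: length_Suc_conv)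
  have "fst (\<Phi> ! k) \<in> carrier_mat (ls' ! Suc k) (ls' ! k) \<and> snd (\<Phi> ! k) \<in> carrier_vec (ls' ! Suc k)"
    if "k < length \<Phi>" for k
    using Cons.prems(3)[rule_format, of "Suc k"] that ls by simp
  then have IH: "is_net (hd ls') (last ls') \<Phi>"
    using Cons.IH[of ls'] Cons.prems ls by simp
  have "dim_row W = l'" "dim_col W = l" "dim_vec B = l'"
    using Cons.prems(3)[rule_format, of 0] ls ls' L by auto
  then show ?case
    using IH Cons.prems(2) ls ls' L by auto
qed

lemma layers_of_is_net:
  assumes "is_net m n \<Phi>"
  shows "\<exists>ls. length ls = Suc (length \<Phi>) \<and> (\<forall>l\<in>set ls. 1 \<le> l) \<and> hd ls = m \<and>
    (\<forall>k<length \<Phi>. fst (\<Phi> ! k) \<in> carrier_mat (ls ! Suc k) (ls ! k) \<and>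
       snd (\<Phi> ! k) \<in> carrier_vec (ls ! Suc k))"
  using assms
proof (induction m n \<Phi> rule: is_net.induct)
  case (1 m n)
  then show ?case by (intro exI[of _ "[m]"]) auto
next
  case (2 m n W B \<Phi>)
  then obtain ls where ls: "length ls = Suc (length \<Phi>)" "\<forall>l\<in>set ls. 1 \<le> l" "hd ls = dim_row W"
    "\<forall>k<length \<Phi>. fst (\<Phi> ! k) \<in> carrier_mat (ls ! Suc k) (ls ! k) \<and>
       snd (\<Phi> ! k) \<in> carrier_vec (ls ! Suc k)"
    by auto
  then have "ls ! 0 = dim_row W" by (cases ls) auto
  with 2 ls show ?case
    by (intro exI[of _ "m # ls"])
       (auto simp: nth_Cons less_Suc_eq_0_disj intro: carrier_matI carrier_vecI split: nat.split)
qed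

lemma ANNs_iff_is_net: "\<Phi> \<in> ANNs \<longleftrightarrow> \<Phi> \<noteq> [] \<and> (\<exists>m n. is_net m n \<Phi>)"
proof
  assume "\<Phi> \<in> ANNs"
  then show "\<Phi> \<noteq> [] \<and> (\<exists>m n. is_net m n \<Phi>)"
    unfolding ANNs_def by (auto dest!: is_net_of_layers)
next
  assume "\<Phi> \<noteq> [] \<and> (\<exists>m n. is_net m n \<Phi>)"
  then obtain m n where "\<Phi> \<noteq> []" "is_net m n \<Phi>" by blast
  from this(1) layers_of_is_net[OF this(2)] show "\<Phi> \<in> ANNs"
    unfolding ANNs_def by (auto simp: Suc_le_eq)
qed

lemma hd_layer_dims:
  assumes "is_net m n \<Phi>" "\<Phi> \<noteq> []"
  shows "hd (layer_dims \<Phi>) = m"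
  using assms by (cases \<Phi>) (auto simp: layer_dims_def)

lemma num_params_eq_net_size:
  assumes "is_net m n \<Phi>"
  shows "num_params \<Phi> = net_size \<Phi>"
proof -
  \<comment> \<open>Prepending \<open>m\<close> by hand keeps the statement meaningful for an empty
    tail, where \<open>layer_dims\<close> would take the head of an empty list.\<close>
  have "(\<Sum>k<length \<Phi>. (map (\<lambda>(W, B). dim_row W) \<Phi>) ! k * ((m # map (\<lambda>(W, B). dim_row W) \<Phi>) ! k + 1))
    = net_size \<Phi>"
    using assms
  proof (induction m n \<Phi> rule: is_net.induct)
    case (2 m n W B \<Phi>)
    then show ?case
      by (auto simp: sum.lessThan_Suc_shift simp del: sum.lessThan_Suc)
  qed simp
  moreover have "num_params \<Phi> = (\<Sum>k<length \<Phi>. layer_dims \<Phi> ! Suc k * (layer_dims \<Phi> ! k + 1))"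
    unfolding num_params_def
    by (rule sum.reindex_bij_witness[of _ Suc "\<lambda>k. k - 1"]) auto
  moreover have "layer_dims \<Phi> = m # map (\<lambda>(W, B). dim_row W) \<Phi>" if "\<Phi> \<noteq> []"
    using that assms by (cases \<Phi>) (auto simp: layer_dims_def)
  ultimately show ?thesis
    by (cases "\<Phi> = []") simp_all
qed

section \<open>Realizations of networks as continuous functions\<close>

lemma net_eval_carrier:
  assumes "is_net m n \<Phi>" "\<Phi> \<noteq> []" "x \<in> carrier_vec m"
  shows "net_eval a \<Phi> x \<in> carrier_vec n"
  using assms
proof (induction \<Phi> arbitrary: m x)
  case (Cons L \<Phi>)
  obtain W B where L: "L = (W, B)" by fastforce
  with Cons.prems have "map_vec a (W *\<^sub>v x + B) \<in> carrier_vec (dim_row W)"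
    by (intro carrier_vecI) auto
  with Cons L show ?case
    by (cases "\<Phi> = []") (auto simp: net_eval_Cons intro: carrier_vecI)
qed simp

lemma continuous_map_affine:
  assumes W: "W \<in> carrier_mat n m" and B: "B \<in> carrier_vec n"
  shows "continuous_map (Rn m) (Rn n) (\<lambda>x. W *\<^sub>v x + B)"
  unfolding continuous_map_Rn_iff
proof (intro conjI ballI allI impI)
  fix j assume j: "j < n"
  have "continuous_map (Rn m) euclideanreal (\<lambda>x. (\<Sum>k<m. W $$ (j, k) * x $ k) + B $ j)"
    by (intro continuous_map_add continuous_map_sum continuous_map_real_mult
        continuous_map_Rn_index) auto
  moreover have "(\<Sum>k<m. W $$ (j, k) * x $ k) + B $ j = (W *\<^sub>v x + B) $ j"
    if "x \<in> topspace (Rn m)" for x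
    using that W B j by (auto simp: scalar_prod_def atLeast0LessThan intro!: sum.cong)
  ultimately show "continuous_map (Rn m) euclideanreal (\<lambda>x. (W *\<^sub>v x + B) $ j)"
    by (rule continuous_map_eq) simp
qed (use W B in auto)

lemma continuous_map_net_eval:
  assumes "continuous_on UNIV a" "is_net m n \<Phi>" "\<Phi> \<noteq> []"
  shows "continuous_map (Rn m) (Rn n) (net_eval a \<Phi>)"
  using assms(2,3)
proof (induction \<Phi> arbitrary: m)
  case (Cons L \<Phi>)
  obtain W B where L: "L = (W, B)" by fastforce
  define k where "k = dim_row W"
  have WB: "W \<in> carrier_mat k m" "B \<in> carrier_vec k" "is_net k n \<Phi>"
    using Cons.prems L by (auto simp: k_def intro: carrier_matI carrier_vecI)
  note aff = continuous_map_affine[OF WB(1,2)]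
  show ?case
  proof (cases "\<Phi> = []")
    case True
    then show ?thesis using aff WB(3) L by simp
  next
    case False
    have a: "continuous_map euclideanreal euclideanreal a"
      using assms(1) by simp
    have "continuous_map (Rn m) (Rn (k)) (\<lambda>x. map_vec a (W *\<^sub>v x + B))"
      unfolding continuous_map_Rn_iff
    proof (intro conjI ballI allI impI)
      fix j assume j: "j < k"
      then have "continuous_map (Rn m) euclideanreal (\<lambda>x. a ((W *\<^sub>v x + B) $ j))"
        using continuous_map_compose[OF _ a] aff by (force simp: continuous_map_Rn_iff comp_def)
      then show "continuous_map (Rn m) euclideanreal (\<lambda>x. map_vec a (W *\<^sub>v x + B) $ j)"
        by (rule continuous_map_eq) (use WB j in auto)
    qed (use WB in auto)
    from continuous_map_compose[OF this Cons.IH[OF WB(3) False]] show ?thesis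
      using False L by (auto simp: comp_def net_eval_Cons intro: continuous_map_eq)
  qed
qed simp

lemma realization_C_fun:
  assumes "continuous_on UNIV a" "is_net m n \<Phi>" "\<Phi> \<noteq> []"
  shows "realization a \<Phi> \<in> C_fun m n"
proof -
  have "dom (realization a \<Phi>) = carrier_vec m"
    using hd_layer_dims[OF assms(2,3)] by (auto simp: realization_def split: if_splits)
  moreover have "continuous_map (Rn m) (Rn n) (\<lambda>x. the (realization a \<Phi> x))"
    using continuous_map_net_eval[OF assms]
    by (rule continuous_map_eq) (simp add: realization_def hd_layer_dims[OF assms(2,3)])
  ultimately show ?thesis by (simp add: C_fun_iff)
qed

lemma realization_eq:
  assumes "is_net m n \<Phi>" "\<Phi> \<noteq> []" "x \<in> carrier_vec m"
  shows "the (realization a \<Phi> x) = net_eval a \<Phi> x"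
  using assms by (simp add: realization_def hd_layer_dims)

text \<open>A network realizes an element of \<open>C_fun\<close> for its own end dimensions, and
  these are unique. Thus the membership stated in \<open>approx_space\<close> becomes information on
  the shapes of the layers.\<close>

lemma ANNs_realizationE:
  assumes "continuous_on UNIV a" "\<Phi> \<in> ANNs" "realization a \<Phi> \<in> C_fun m n"
  shows "is_net m n \<Phi>" "\<Phi> \<noteq> []"
proof -
  from assms(2) obtain m' n' where "is_net m' n' \<Phi>" and ne: "\<Phi> \<noteq> []"
    unfolding ANNs_iff_is_net by blast
  then show "is_net m n \<Phi>" "\<Phi> \<noteq> []"
    using C_fun_unique_dims[OF assms(3) realization_C_fun[OF assms(1)]] by blast+
qed

subsection \<open>Composition\<close>

text \<open>In \<open>net_comp \<Psi> \<Phi>\<close> the network \<open>\<Phi>\<close> is applied first.\<close>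

fun net_comp :: "ann \<Rightarrow> ann \<Rightarrow> ann" where
  "net_comp \<Psi> [] = \<Psi>"
| "net_comp [] [(W, B)] = [(W, B)]"
| "net_comp ((V, C) # \<Psi>) [(W, B)] = (V * W, V *\<^sub>v B + C) # \<Psi>"
| "net_comp \<Psi> ((W, B) # L # \<Phi>) = (W, B) # net_comp \<Psi> (L # \<Phi>)"

lemma net_comp_ne: "\<Phi> \<noteq> [] \<Longrightarrow> net_comp \<Psi> \<Phi> \<noteq> []"
  by (induction \<Psi> \<Phi> rule: net_comp.induct) auto

lemma is_net_comp:
  assumes "is_net m k \<Phi>" "is_net k n \<Psi>" "\<Phi> \<noteq> []"
  shows "is_net m n (net_comp \<Psi> \<Phi>)"
  using assms by (induction \<Psi> \<Phi> arbitrary: m rule: net_comp.induct) auto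

lemma net_eval_comp:
  assumes "is_net m k \<Phi>" "is_net k n \<Psi>" "\<Phi> \<noteq> []" "\<Psi> \<noteq> []" "x \<in> carrier_vec m"
  shows "net_eval a (net_comp \<Psi> \<Phi>) x = net_eval a \<Psi> (net_eval a \<Phi> x)"
  using assms
proof (induction \<Psi> \<Phi> arbitrary: m x rule: net_comp.induct)
  case (3 V C \<Psi> W B)
  define l where "l = dim_row V"
  have dims: "V \<in> carrier_mat l k" "W \<in> carrier_mat k m" "B \<in> carrier_vec k" "C \<in> carrier_vec l"
    using 3 by (auto simp: l_def intro: carrier_matI carrier_vecI)
  have "V *\<^sub>v (W *\<^sub>v x + B) + C = V *\<^sub>v (W *\<^sub>v x) + V *\<^sub>v B + C"
    using dims 3(5) by (simp add: mult_add_distrib_mat_vec)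
  also have "\<dots> = V * W *\<^sub>v x + (V *\<^sub>v B + C)"
    using dims 3(5) by (simp add: assoc_add_vec[of _ l])
  finally have "V *\<^sub>v (W *\<^sub>v x + B) + C = V * W *\<^sub>v x + (V *\<^sub>v B + C)" .
  with 3 show ?case
    by (cases \<Psi>) auto
next
  case (4 \<Psi> W B L \<Phi>)
  then have "map_vec a (W *\<^sub>v x + B) \<in> carrier_vec (dim_row W)"
    by (intro carrier_vecI) auto
  with 4 show ?case
    by (auto simp: net_eval_Cons net_comp_ne)
qed auto

lemma dim_row_hd_le_net_size:
  assumes "is_net m n \<Phi>" "\<Phi> \<noteq> []"
  shows "dim_row (fst (hd \<Phi>)) \<le> net_size \<Phi>"
  using assms by (cases \<Phi>) auto

text \<open>Only the merged layer is new. It has \<open>dim_row V\<close> rows, and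
  \<open>dim_col W + 1\<close> is at most the size of the layer \<open>(W, B)\<close>, which has at
  least one row; so merging costs at most \<open>p\<close> times the size of
  \<open>\<Phi>\<close>.\<close>

lemma net_size_comp:
  assumes "is_net m k \<Phi>" "is_net k n \<Psi>" "\<Phi> \<noteq> []" "\<Psi> \<noteq> []" "dim_row (fst (hd \<Psi>)) \<le> p"
  shows "net_size (net_comp \<Psi> \<Phi>) \<le> net_size \<Psi> + net_size \<Phi> + p * net_size \<Phi>"
  using assms
proof (induction \<Psi> \<Phi> arbitrary: m rule: net_comp.induct)
  case (3 V C \<Psi> W B)
  then have "1 \<le> dim_row W" "dim_row V \<le> p" using is_net_pos(1)[of k n "(V,C) # \<Psi>"] by auto
  moreover have "1 * (dim_col W + 1) \<le> dim_row W * (dim_col W + 1)"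
    using calculation(1) by (intro mult_right_mono) auto
  ultimately have "dim_row V * (dim_col W + 1) \<le> p * (dim_row W * (dim_col W + 1))"
    by (intro mult_mono) auto
  then show ?case by simp
next
  case (4 \<Psi> W B L \<Phi>)
  have "net_size (net_comp \<Psi> (L # \<Phi>)) \<le> net_size \<Psi> + net_size (L # \<Phi>) + p * net_size (L # \<Phi>)"
    using 4 by auto
  also have "p * net_size (L # \<Phi>) \<le> p * net_size ((W, B) # L # \<Phi>)"
    by (intro mult_left_mono) auto
  finally show ?case by simp
qed auto

text \<open>The first layer of the composite is that of \<open>\<Phi>\<close> if
  \<open>\<Phi>\<close> has several layers, and otherwise the merged one, with the rows of the first
  layer of \<open>\<Psi>\<close>. The bound \<open>p\<close> therefore survives any number of
  compositions.\<close>

lemma dim_row_hd_comp: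
  assumes "is_net m k \<Phi>" "\<Phi> \<noteq> []" "\<Psi> \<noteq> []" "dim_row (fst (hd \<Psi>)) \<le> p" "net_size \<Phi> \<le> p"
  shows "dim_row (fst (hd (net_comp \<Psi> \<Phi>))) \<le> p"
  using assms dim_row_hd_le_net_size[OF assms(1,2)] by (cases "(\<Psi>, \<Phi>)" rule: net_comp.cases) auto

text \<open>Each step is attached at the input side, so the growing network is the
  \<open>\<Psi>\<close> of \<open>net_size_comp\<close>, of which only the row count of the first
  layer multiplies the cost. That count stays at most \<open>q\<close>, hence each step adds at most
  \<open>q + q * q\<close>.\<close>

lemma net_comp_iterate:
  assumes \<Phi>: "is_net d d \<Phi>" "\<Phi> \<noteq> []" "net_size \<Phi> \<le> q"
    and \<Gamma>: "is_net d n \<Gamma>" "\<Gamma> \<noteq> []" "net_size \<Gamma> \<le> q"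
  defines "\<Theta> \<equiv> \<lambda>k. ((\<lambda>\<Psi>. net_comp \<Psi> \<Phi>) ^^ k) \<Gamma>"
  shows "is_net d n (\<Theta> k)" "\<Theta> k \<noteq> []" "net_size (\<Theta> k) \<le> q + k * (q + q * q)"
    "x \<in> carrier_vec d \<Longrightarrow> net_eval a (\<Theta> k) x = net_eval a \<Gamma> ((net_eval a \<Phi> ^^ k) x)"
proof -
  have *: "is_net d n (\<Theta> k) \<and> \<Theta> k \<noteq> [] \<and> dim_row (fst (hd (\<Theta> k))) \<le> q \<and>
    net_size (\<Theta> k) \<le> q + k * (q + q * q)" for k
  proof (induction k)
    case 0
    then show ?case
      using \<Gamma> dim_row_hd_le_net_size[OF \<Gamma>(1,2)] by (auto simp: \<Theta>_def)
  next
    case (Suc k)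
    have S: "\<Theta> (Suc k) = net_comp (\<Theta> k) \<Phi>" by (simp add: \<Theta>_def)
    have "net_size (\<Theta> (Suc k)) \<le> net_size (\<Theta> k) + net_size \<Phi> + q * net_size \<Phi>"
      unfolding S using Suc \<Phi> by (intro net_size_comp) auto
    also have "\<dots> \<le> (q + k * (q + q * q)) + q + q * q"
      using Suc \<Phi>(3) by (intro add_mono mult_left_mono) auto
    finally show ?case
      using Suc \<Phi> unfolding S by (auto intro: is_net_comp dim_row_hd_comp simp: net_comp_ne)
  qed
  then show "is_net d n (\<Theta> k)" "\<Theta> k \<noteq> []" "net_size (\<Theta> k) \<le> q + k * (q + q * q)"
    by auto
  show "x \<in> carrier_vec d \<Longrightarrow> net_eval a (\<Theta> k) x = net_eval a \<Gamma> ((net_eval a \<Phi> ^^ k) x)"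
  proof (induction k arbitrary: x)
    case (Suc k)
    have y: "net_eval a \<Phi> x \<in> carrier_vec d"
      using net_eval_carrier[OF \<Phi>(1,2) Suc.prems] .
    have "net_eval a (\<Theta> (Suc k)) x = net_eval a (net_comp (\<Theta> k) \<Phi>) x"
      by (simp add: \<Theta>_def)
    also have "\<dots> = net_eval a (\<Theta> k) (net_eval a \<Phi> x)"
      using * Suc.prems \<Phi> by (intro net_eval_comp[of d d _ n]) auto
    finally show ?case
      using Suc.IH[OF y] by (simp add: funpow_swap1)
  qed (simp add: \<Theta>_def)
qed

subsection \<open>Networks for the Euler steps\<close>

text \<open>
  The identity of \<open>R^d\<close> is realized by a network \<open>(A, b), (A', b')\<close> with one hidden layer. The
  state \<open>a (A x + b)\<close> of this layer, from which \<open>x\<close> can be recovered affinely, is carried along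
  with the hidden layers of \<open>\<Phi>\<close>, so that \<open>x\<close> is still available at the output.
\<close>

fun euler_tail :: "real \<Rightarrow> real mat \<times> real Matrix.vec \<Rightarrow> real mat \<times> real Matrix.vec \<Rightarrow> ann \<Rightarrow> ann" where
  "euler_tail h (A, b) (A', b') [] = []"
| "euler_tail h (A, b) (A', b') [(W, B)] =
     [(four_block_mat (h \<cdot>\<^sub>m W) A' (0\<^sub>m 0 (dim_col W)) (0\<^sub>m 0 (dim_col A')), h \<cdot>\<^sub>v B + b')]"
| "euler_tail h (A, b) (A', b') ((W, B) # L # \<Phi>) =
     (four_block_mat W (0\<^sub>m (dim_row W) (dim_col A')) (0\<^sub>m (dim_row A) (dim_col W)) (A * A'),
      B @\<^sub>v (A *\<^sub>v b' + b)) # euler_tail h (A, b) (A', b') (L # \<Phi>)"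

text \<open>At the input there is no hidden state yet, so the first layer stacks \<open>W\<close> on
  \<open>A\<close> and creates the state from x. A network with one layer has no hidden layer at
  all; the Euler step is then itself affine.\<close>

fun euler_net :: "real \<Rightarrow> real mat \<times> real Matrix.vec \<Rightarrow> real mat \<times> real Matrix.vec \<Rightarrow> ann \<Rightarrow> ann" where
  "euler_net h (A, b) (A', b') [] = []"
| "euler_net h (A, b) (A', b') [(W, B)] = [(1\<^sub>m (dim_row W) + h \<cdot>\<^sub>m W, h \<cdot>\<^sub>v B)]"
| "euler_net h (A, b) (A', b') ((W, B) # L # \<Phi>) =
     (W @\<^sub>r A, B @\<^sub>v b) # euler_tail h (A, b) (A', b') (L # \<Phi>)"

lemma map_vec_append: "map_vec f (x @\<^sub>v y) = map_vec f x @\<^sub>v map_vec f y"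
  by (intro eq_vecI) auto

lemma append_vec_dim_0: "y \<in> carrier_vec 0 \<Longrightarrow> x @\<^sub>v y = x"
  by (intro eq_vecI) auto

locale identity_network =
  fixes a :: "real \<Rightarrow> real" and d i :: nat and A A' :: "real mat" and b b' :: "real Matrix.vec"
  assumes A: "A \<in> carrier_mat i d" and b: "b \<in> carrier_vec i"
    and A': "A' \<in> carrier_mat d i" and b': "b' \<in> carrier_vec d"
    and identity: "x \<in> carrier_vec d \<Longrightarrow> A' *\<^sub>v map_vec a (A *\<^sub>v x + b) + b' = x"
begin

lemma euler_tail_ne: "\<Phi> \<noteq> [] \<Longrightarrow> euler_tail h (A, b) (A', b') \<Phi> \<noteq> []"
  by (cases "(h, (A, b), (A', b'), \<Phi>)" rule: euler_tail.cases) auto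

text \<open>The invariant is that the input consists of the hidden vector \<open>u\<close> of
  \<open>\<Phi>\<close> followed by the state of the identity network. Decoding by
  \<open>(A', b')\<close> and encoding again by \<open>(A, b)\<close> are merged into the block
  \<open>A * A'\<close>, so each activation reproduces the same state; the last layer only decodes
  and adds \<open>h\<close> times the output of \<open>\<Phi>\<close>.\<close>

lemma euler_tail_net:
  assumes "is_net m d \<Phi>" "\<Phi> \<noteq> []"
  shows "is_net (m + i) d (euler_tail h (A, b) (A', b') \<Phi>)"
    "net_size (euler_tail h (A, b) (A', b') \<Phi>) \<le> (1 + i)\<^sup>2 * net_size \<Phi>"
    "\<lbrakk>u \<in> carrier_vec m; x \<in> carrier_vec d\<rbrakk> \<Longrightarrow>
      net_eval a (euler_tail h (A, b) (A', b') \<Phi>) (u @\<^sub>v map_vec a (A *\<^sub>v x + b)) =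
      x + h \<cdot>\<^sub>v net_eval a \<Phi> u"
proof -
  \<comment> \<open>Both widths of a layer grow by \<open>i\<close>; since \<open>l\<close> and
    \<open>k + 1\<close> are at least 1, each gains at most a factor \<open>1 + i\<close>.\<close>
  have size: "(l + i) * (k + i + 1) \<le> (1 + i)\<^sup>2 * (l * (k + 1))" if "1 \<le> l" for l k :: nat
  proof -
    have "l + i \<le> l * (1 + i)" "k + i + 1 \<le> (k + 1) * (1 + i)"
      using that by simp_all
    then have "(l + i) * (k + i + 1) \<le> (l * (1 + i)) * ((k + 1) * (1 + i))"
      by (rule mult_mono) auto
    then show ?thesis by (simp add: power2_eq_square algebra_simps)
  qed
  have "is_net (m + i) d (euler_tail h (A, b) (A', b') \<Phi>) \<and>
    net_size (euler_tail h (A, b) (A', b') \<Phi>) \<le> (1 + i)\<^sup>2 * net_size \<Phi> \<and>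
    (u \<in> carrier_vec m \<longrightarrow> x \<in> carrier_vec d \<longrightarrow>
      net_eval a (euler_tail h (A, b) (A', b') \<Phi>) (u @\<^sub>v map_vec a (A *\<^sub>v x + b)) =
      x + h \<cdot>\<^sub>v net_eval a \<Phi> u)"
    using assms
  proof (induction h "(A, b)" "(A', b')" \<Phi> arbitrary: m u rule: euler_tail.induct)
    case (2 h W B)
    then have W: "W \<in> carrier_mat d m" and B: "B \<in> carrier_vec d" and pos: "1 \<le> m" "1 \<le> d"
      by (auto intro: carrier_matI carrier_vecI)
    \<comment> \<open>The lower blocks have no rows: the block matrix is just the two upper blocks
      side by side.\<close>
    have eval: "four_block_mat (h \<cdot>\<^sub>m W) A' (0\<^sub>m 0 (dim_col W)) (0\<^sub>m 0 (dim_col A'))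
        *\<^sub>v (u @\<^sub>v map_vec a (A *\<^sub>v x + b)) + (h \<cdot>\<^sub>v B + b') = x + h \<cdot>\<^sub>v (W *\<^sub>v u + B)"
      if u: "u \<in> carrier_vec m" and x: "x \<in> carrier_vec d"
    proof -
      define v where "v = map_vec a (A *\<^sub>v x + b)"
      have v: "v \<in> carrier_vec i" using A b x by (auto simp: v_def)
      have "four_block_mat (h \<cdot>\<^sub>m W) A' (0\<^sub>m 0 (dim_col W)) (0\<^sub>m 0 (dim_col A')) *\<^sub>v (u @\<^sub>v v) =
        (h \<cdot>\<^sub>m W *\<^sub>v u + A' *\<^sub>v v) @\<^sub>v (0\<^sub>m 0 (dim_col W) *\<^sub>v u + 0\<^sub>m 0 (dim_col A') *\<^sub>v v)"
        using W A' u v by (intro four_block_mat_mult_vec) auto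
      also have "\<dots> = h \<cdot>\<^sub>m W *\<^sub>v u + A' *\<^sub>v v"
        by (rule append_vec_dim_0) (auto intro!: carrier_vecI)
      also have "h \<cdot>\<^sub>m W *\<^sub>v u = h \<cdot>\<^sub>v (W *\<^sub>v u)"
        using W u by auto
      finally have "four_block_mat (h \<cdot>\<^sub>m W) A' (0\<^sub>m 0 (dim_col W)) (0\<^sub>m 0 (dim_col A')) *\<^sub>v (u @\<^sub>v v)
        + (h \<cdot>\<^sub>v B + b') = (A' *\<^sub>v v + b') + h \<cdot>\<^sub>v (W *\<^sub>v u + B)"
        using W B u v A' b' by (intro eq_vecI) (auto simp: algebra_simps)
      then show ?thesis
        using identity[OF x] by (simp add: v_def)
    qed
    \<comment> \<open>The last layer does not pass on the state and has only \<open>d\<close> rows;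
      the estimate for \<open>d + i\<close> rows covers it.\<close>
    have "d * (m + i + 1) \<le> (d + i) * (m + i + 1)" by (intro mult_right_mono) auto
    also have "\<dots> \<le> (1 + i)\<^sup>2 * (d * (m + 1))" by (rule size[OF pos(2)])
    finally show ?case
      using W B A' b' pos eval by (auto simp: carrier_matD)
  next
    case (3 h W B L \<Phi>)
    define k where "k = dim_row W"
    have W: "W \<in> carrier_mat k m" and B: "B \<in> carrier_vec k" and pos: "1 \<le> m" "1 \<le> k"
      and net: "is_net k d (L # \<Phi>)"
      using 3(2) is_net_pos(1)[of k d "L # \<Phi>"] by (auto simp: k_def intro: carrier_matI carrier_vecI)
    define M where "M = four_block_mat W (0\<^sub>m k i) (0\<^sub>m i m) (A * A')"
    have tail: "euler_tail h (A, b) (A', b') ((W, B) # L # \<Phi>) =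
      (M, B @\<^sub>v (A *\<^sub>v b' + b)) # euler_tail h (A, b) (A', b') (L # \<Phi>)"
      using W A A' by (auto simp: M_def)
    have M: "M \<in> carrier_mat (k + i) (m + i)"
      using W A A' by (auto simp: M_def)
    have eval: "M *\<^sub>v (u @\<^sub>v map_vec a (A *\<^sub>v x + b)) + (B @\<^sub>v (A *\<^sub>v b' + b)) =
      (W *\<^sub>v u + B) @\<^sub>v (A *\<^sub>v x + b)" if u: "u \<in> carrier_vec m" and x: "x \<in> carrier_vec d"
    proof -
      define v where "v = map_vec a (A *\<^sub>v x + b)"
      have v: "v \<in> carrier_vec i" using A b x by (auto simp: v_def)
      have "M *\<^sub>v (u @\<^sub>v v) = (W *\<^sub>v u + 0\<^sub>m k i *\<^sub>v v) @\<^sub>v (0\<^sub>m i m *\<^sub>v u + A * A' *\<^sub>v v)"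
        using W A A' u v unfolding M_def by (subst four_block_mat_mult_vec) auto
      also have "W *\<^sub>v u + 0\<^sub>m k i *\<^sub>v v = W *\<^sub>v u"
        using W u v by (intro eq_vecI) auto
      also have "0\<^sub>m i m *\<^sub>v u + A * A' *\<^sub>v v = A *\<^sub>v (A' *\<^sub>v v)"
        using A A' u v by (intro eq_vecI) auto
      finally have Muv: "M *\<^sub>v (u @\<^sub>v v) = W *\<^sub>v u @\<^sub>v A *\<^sub>v (A' *\<^sub>v v)" .
      have "M *\<^sub>v (u @\<^sub>v v) + (B @\<^sub>v (A *\<^sub>v b' + b)) =
        (W *\<^sub>v u + B) @\<^sub>v (A *\<^sub>v (A' *\<^sub>v v) + (A *\<^sub>v b' + b))"
        unfolding Muv using W u B A A' v b b' by (subst append_vec_add[of _ k _ _ i]) auto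
      \<comment> \<open>The bracket decodes the state and equals \<open>x\<close> by
        \<open>identity\<close>, so the pre-activation \<open>A *\<^sub>v x + b\<close> is
        regenerated.\<close>
      also have "A *\<^sub>v (A' *\<^sub>v v) + (A *\<^sub>v b' + b) = A *\<^sub>v (A' *\<^sub>v v + b') + b"
        using A A' v b b' by (simp add: mult_add_distrib_mat_vec[of _ i d] assoc_add_vec[of _ i])
      finally show ?thesis
        using identity[OF x] by (simp add: v_def)
    qed
    note IH = 3(1)[OF net]
    have "(k + i) * (m + i + 1) \<le> (1 + i)\<^sup>2 * (k * (m + 1))" by (rule size[OF pos(2)])
    moreover have "net_size (euler_tail h (A, b) (A', b') (L # \<Phi>)) \<le> (1 + i)\<^sup>2 * net_size (L # \<Phi>)"
      using IH by blast
    ultimately have "(k + i) * (m + i + 1) + net_size (euler_tail h (A, b) (A', b') (L # \<Phi>))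
      \<le> (1 + i)\<^sup>2 * (k * (m + 1) + net_size (L # \<Phi>))"
      unfolding distrib_left[of "(1 + i)\<^sup>2"] by (rule add_mono)
    moreover have "map_vec a (W *\<^sub>v u + B) \<in> carrier_vec k" if "u \<in> carrier_vec m"
      using W B that by auto
    ultimately show ?case
      using IH W B A b A' b' pos M eval
      by (auto simp: net_eval_Cons euler_tail_ne map_vec_append tail simp del: euler_tail.simps
          net_size.simps(2)[of _ _ "L # \<Phi>"])
  qed auto
  then show "is_net (m + i) d (euler_tail h (A, b) (A', b') \<Phi>)"
    "net_size (euler_tail h (A, b) (A', b') \<Phi>) \<le> (1 + i)\<^sup>2 * net_size \<Phi>"
    "\<lbrakk>u \<in> carrier_vec m; x \<in> carrier_vec d\<rbrakk> \<Longrightarrow>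
      net_eval a (euler_tail h (A, b) (A', b') \<Phi>) (u @\<^sub>v map_vec a (A *\<^sub>v x + b)) =
      x + h \<cdot>\<^sub>v net_eval a \<Phi> u"
    by blast+
qed

lemma euler_net:
  assumes "is_net d d \<Phi>" "\<Phi> \<noteq> []"
  shows "is_net d d (euler_net h (A, b) (A', b') \<Phi>)"
    "euler_net h (A, b) (A', b') \<Phi> \<noteq> []"
    "net_size (euler_net h (A, b) (A', b') \<Phi>) \<le> (1 + i)\<^sup>2 * net_size \<Phi>"
    "x \<in> carrier_vec d \<Longrightarrow>
      net_eval a (euler_net h (A, b) (A', b') \<Phi>) x = x + h \<cdot>\<^sub>v net_eval a \<Phi> x"
proof -
  have "is_net d d (euler_net h (A, b) (A', b') \<Phi>) \<and>
    euler_net h (A, b) (A', b') \<Phi> \<noteq> [] \<and>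
    net_size (euler_net h (A, b) (A', b') \<Phi>) \<le> (1 + i)\<^sup>2 * net_size \<Phi> \<and>
    (x \<in> carrier_vec d \<longrightarrow>
      net_eval a (euler_net h (A, b) (A', b') \<Phi>) x = x + h \<cdot>\<^sub>v net_eval a \<Phi> x)"
  proof (cases "(h, (A, b), (A', b'), \<Phi>)" rule: euler_net.cases)
    case (2 h' _ _ _ _ W B)
    then have W: "W \<in> carrier_mat d d" and B: "B \<in> carrier_vec d" and pos: "1 \<le> d"
      using assms by (auto intro: carrier_matI carrier_vecI)
    have "(1\<^sub>m d + h \<cdot>\<^sub>m W) *\<^sub>v x + h \<cdot>\<^sub>v B = x + h \<cdot>\<^sub>v (W *\<^sub>v x + B)" if x: "x \<in> carrier_vec d"
    proof -
      have "(1\<^sub>m d + h \<cdot>\<^sub>m W) *\<^sub>v x = 1\<^sub>m d *\<^sub>v x + h \<cdot>\<^sub>m W *\<^sub>v x"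
        using W x by (intro add_mult_distrib_mat_vec) auto
      also have "\<dots> = x + h \<cdot>\<^sub>v (W *\<^sub>v x)"
        using W x by auto
      finally show ?thesis
        using W B x by (intro eq_vecI) (auto simp: algebra_simps)
    qed
    with 2 W B pos show ?thesis
      by (auto simp: carrier_matD)
  next
    case (3 h' _ _ _ _ W B L \<Phi>')
    define k where "k = dim_row W"
    have W: "W \<in> carrier_mat k d" and B: "B \<in> carrier_vec k"
      and pos: "1 \<le> k" "1 \<le> d" and net: "is_net k d (L # \<Phi>')"
      using assms 3 is_net_pos(1)[of k d "L # \<Phi>'"]
      by (auto simp: k_def intro: carrier_matI carrier_vecI)
    have WA: "W @\<^sub>r A \<in> carrier_mat (k + i) d"
      using W A by auto
    have eval: "(W @\<^sub>r A) *\<^sub>v x + (B @\<^sub>v b) = (W *\<^sub>v x + B) @\<^sub>v (A *\<^sub>v x + b)"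
      if x: "x \<in> carrier_vec d"
      using mat_mult_append[OF W A x] W A B b x by (simp add: append_vec_add[of _ k _ _ i])
    note IH = euler_tail_net[OF net list.distinct(2), where h = h]
    \<comment> \<open>In the first layer only the output width grows, since its input is still
      \<open>x\<close>.\<close>
    have "k + i \<le> k * (1 + i)" using pos by simp
    also have "\<dots> \<le> k * (1 + i)\<^sup>2" by (simp add: power2_eq_square)
    finally have "(k + i) * (d + 1) \<le> k * (1 + i)\<^sup>2 * (d + 1)" by (rule mult_right_mono) simp
    then have "(k + i) * (d + 1) + net_size (euler_tail h (A, b) (A', b') (L # \<Phi>'))
      \<le> (1 + i)\<^sup>2 * (k * (d + 1)) + (1 + i)\<^sup>2 * net_size (L # \<Phi>')"
      using IH(2) by (intro add_mono) (simp_all add: algebra_simps)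
    then have "(k + i) * (d + 1) + net_size (euler_tail h (A, b) (A', b') (L # \<Phi>'))
      \<le> (1 + i)\<^sup>2 * (k * (d + 1) + net_size (L # \<Phi>'))"
      unfolding distrib_left[of "(1 + i)\<^sup>2"] .
    moreover have "map_vec a (W *\<^sub>v x + B) \<in> carrier_vec k" if "x \<in> carrier_vec d"
      using W B that by auto
    moreover have "\<Phi> = (W, B) # L # \<Phi>'" using 3 by simp
    moreover have "dim_row (W @\<^sub>r A) = k + i" "dim_col (W @\<^sub>r A) = d"
      using WA by auto
    ultimately show ?thesis
      using IH(1) IH(3) W A B b pos eval
      by (auto simp: net_eval_Cons euler_tail_ne map_vec_append carrier_matD
          simp del: net_size.simps(2)[of _ _ "L # \<Phi>'"])
  qed (use assms in auto)
  then show "is_net d d (euler_net h (A, b) (A', b') \<Phi>)"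
    "euler_net h (A, b) (A', b') \<Phi> \<noteq> []"
    "net_size (euler_net h (A, b) (A', b') \<Phi>) \<le> (1 + i)\<^sup>2 * net_size \<Phi>"
    "x \<in> carrier_vec d \<Longrightarrow>
      net_eval a (euler_net h (A, b) (A', b') \<Phi>) x = x + h \<cdot>\<^sub>v net_eval a \<Phi> x"
    by blast+
qed

end

lemma identity_networkE:
  assumes "\<Psi> \<in> ANNs" "1 \<le> d" "layer_dims \<Psi> = [d, i, d]"
    "realization a \<Psi> = restrict_map Some (carrier_vec d)"
  obtains A b A' b' where "identity_network a d i A A' b b'"
proof -
  have "length \<Psi> = 2" using assms(3) by (auto simp: layer_dims_def)
  then obtain A b A' b' where \<Psi>: "\<Psi> = [(A, b), (A', b')]"
    by (auto simp: numeral_2_eq_2 length_Suc_conv)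
  obtain m n where "is_net m n \<Psi>"
    using assms(1) by (auto simp: ANNs_iff_is_net)
  then have dims: "A \<in> carrier_mat i d" "b \<in> carrier_vec i" "A' \<in> carrier_mat d i" "b' \<in> carrier_vec d"
    using assms(3) \<Psi> by (auto simp: layer_dims_def intro: carrier_matI carrier_vecI)
  have "A' *\<^sub>v map_vec a (A *\<^sub>v x + b) + b' = x" if "x \<in> carrier_vec d" for x
  proof -
    have "realization a \<Psi> x = Some x"
      using assms(4) that by simp
    then show ?thesis
      using that assms(3) \<Psi> by (simp add: realization_def)
  qed
  with dims show thesis
    by (intro that) (unfold_locales, auto)
qed

section \<open>Flows of Lipschitz vector fields\<close>

text \<open>Minkowski's inequality for integrals, by duality. With v the vector of integrals, |v|^2
  is the integral of the inner product of v and F, which Cauchy-Schwarz bounds by the integral of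
  |v| B; then one divides by |v| unless it vanishes.\<close>

lemma L2_set_integral_le:
  fixes F :: "nat \<Rightarrow> real \<Rightarrow> real"
  assumes F: "\<And>j. j < d \<Longrightarrow> F j integrable_on {s..t}" and B: "B integrable_on {s..t}"
    and le: "\<And>r. r \<in> {s..t} \<Longrightarrow> L2_set (\<lambda>j. F j r) {..<d} \<le> B r"
  shows "L2_set (\<lambda>j. integral {s..t} (F j)) {..<d} \<le> integral {s..t} B"
proof -
  define v where "v j = integral {s..t} (F j)" for j
  define n where "n = L2_set v {..<d}"
  have n: "0 \<le> n" by (simp add: n_def L2_set_nonneg)
  have B_nonneg: "0 \<le> B r" if "r \<in> {s..t}" for r
    using le[OF that] L2_set_nonneg order_trans by blast
  have int: "(\<lambda>r. \<Sum>j<d. v j * F j r) integrable_on {s..t}"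
    using F by (intro integrable_sum integrable_on_mult_right) auto
  have "n\<^sup>2 = (\<Sum>j<d. v j * v j)"
    by (simp add: n_def L2_set_def power2_eq_square sum_nonneg)
  also have "\<dots> = integral {s..t} (\<lambda>r. \<Sum>j<d. v j * F j r)"
    using F by (subst integral_sum) (auto simp: v_def intro!: integrable_on_mult_right)
  also have "\<dots> \<le> integral {s..t} (\<lambda>r. n * B r)"
  proof (rule integral_le[OF int])
    show "(\<lambda>r. n * B r) integrable_on {s..t}"
      using B by (rule integrable_on_mult_right)
    fix r assume r: "r \<in> {s..t}"
    have "(\<Sum>j<d. v j * F j r) \<le> (\<Sum>j<d. \<bar>v j\<bar> * \<bar>F j r\<bar>)"
      by (intro sum_mono) (metis abs_ge_self abs_mult)
    also have "\<dots> \<le> n * L2_set (\<lambda>j. F j r) {..<d}"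
      unfolding n_def by (rule L2_set_mult_ineq)
    also have "\<dots> \<le> n * B r"
      using le[OF r] n by (rule mult_left_mono)
    finally show "(\<Sum>j<d. v j * F j r) \<le> n * B r" .
  qed
  finally have "n * n \<le> n * integral {s..t} B"
    by (simp add: power2_eq_square)
  moreover have "0 \<le> integral {s..t} B"
    using B B_nonneg by (rule integral_nonneg)
  ultimately have "n \<le> integral {s..t} B"
    using n by (cases "n = 0") auto
  then show ?thesis unfolding n_def v_def .
qed

text \<open>With U s the integral of u over [0, s], the function exp(-L s) (A + L U s) has
  derivative L exp(-L s) (u s - A - L U s), which is nonpositive by hypothesis; so it stays below
  its initial value \<open>A\<close>.\<close>

lemma Gronwall:
  fixes u :: "real \<Rightarrow> real"
  assumes u: "continuous_on {0..T} u"
    and le: "\<And>t. t \<in> {0..T} \<Longrightarrow> u t \<le> A + L * integral {0..t} u"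
    and L: "0 \<le> L" and t: "t \<in> {0..T}"
  shows "u t \<le> A * exp (L * t)"
proof -
  define v where "v s = exp (- L * s) * (A + L * integral {0..s} u)" for s
  have D: "(v has_real_derivative
      exp (- L * s) * (L * u s) + - L * exp (- L * s) * (A + L * integral {0..s} u))
      (at s within {0..T})" if "s \<in> {0..T}" for s
    unfolding v_def
    by (rule derivative_eq_intros integral_has_real_derivative[OF u that] refl | simp)+
  have "v t \<le> v 0"
  proof (rule DERIV_nonpos_imp_decreasing_open[of 0 t v])
    show "0 \<le> t" using t by simp
    have "continuous_on {0..T} v"
      by (rule DERIV_continuous_on) (rule D)
    then show "continuous_on {0..t} v"
      by (rule continuous_on_subset) (use t in auto)
    fix s assume s: "0 < s" "s < t"
    have "exp (- L * s) * (L * u s) + - L * exp (- L * s) * (A + L * integral {0..s} u) =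
      L * exp (- L * s) * (u s - (A + L * integral {0..s} u))"
      by (simp add: algebra_simps)
    also have "\<dots> \<le> 0"
      using le[of s] s t L by (intro mult_nonneg_nonpos) auto
    finally show "\<exists>y. DERIV v s :> y \<and> y \<le> 0"
      using D[of s] s t by (auto simp: at_within_Icc_at)
  qed
  then have "exp (L * t) * v t \<le> exp (L * t) * A"
    by (simp add: v_def)
  moreover have "exp (L * t) * v t = A + L * integral {0..t} u"
    by (simp add: v_def mult.assoc[symmetric] flip: exp_add)
  ultimately show ?thesis
    using le[OF t] by (smt (verit) mult.commute)
qed

section \<open>Growth, stability, existence and uniqueness of the flow\<close>

locale lipschitz_field =
  fixes d :: nat and F :: vfun and L :: real
  assumes F: "F \<in> C_fun d d" and L: "0 \<le> L"
    and lipschitz: "\<lbrakk>x \<in> carrier_vec d; y \<in> carrier_vec d\<rbrakk> \<Longrightarrow>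
      vnorm (the (F x) - the (F y)) \<le> L * vnorm (x - y)"
begin

lemma F_carrier: "x \<in> carrier_vec d \<Longrightarrow> the (F x) \<in> carrier_vec d"
  by (rule C_fun_carrier[OF F])

lemma F_growth:
  assumes x: "x \<in> carrier_vec d"
  shows "vnorm (the (F x)) \<le> vnorm (the (F (0\<^sub>v d))) + L * vnorm x"
proof -
  have "vnorm (the (F x)) \<le> vnorm (the (F (0\<^sub>v d))) + vnorm (the (F x) - the (F (0\<^sub>v d)))"
    using x by (intro vnorm_le_add_diff[of _ d] F_carrier) auto
  also have "vnorm (the (F x) - the (F (0\<^sub>v d))) \<le> L * vnorm (x - 0\<^sub>v d)"
    using x by (intro lipschitz) auto
  also have "x - 0\<^sub>v d = x"
    using x by (intro eq_vecI) auto
  finally show ?thesis by simp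
qed

lemma continuous_on_field:
  assumes "continuous_map (top_of_set S) (Rn d) X" "j < d"
  shows "continuous_on S (\<lambda>s. the (F (X s)) $ j)"
proof -
  have "continuous_map (Rn d) euclideanreal (\<lambda>x. the (F x) $ j)"
    using F assms(2) by (simp add: C_fun_iff continuous_map_Rn_iff)
  from continuous_map_compose[OF assms(1) this] show ?thesis
    by (simp add: comp_def)
qed

lemma continuous_on_vnorm_diff:
  assumes "continuous_map (top_of_set S) (Rn d) X" "continuous_map (top_of_set S) (Rn d) Y"
  shows "continuous_on S (\<lambda>s. vnorm (X s - Y s))"
proof -
  have "continuous_on S (\<lambda>s. sqrt (\<Sum>j<d. (X s $ j - Y s $ j)\<^sup>2))"
    using assms by (intro continuous_intros) (auto simp: continuous_map_Rn_iff)
  then show ?thesis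
    by (rule continuous_on_eq)
       (use assms in \<open>auto simp: vnorm_eq_L2_set[of _ d] L2_set_def continuous_map_Rn_iff\<close>)
qed

lemma flow_solutionD:
  assumes "flow_solution T d F x X" "t \<in> {0..T}" "j < d" "x \<in> carrier_vec d"
  shows "X t \<in> carrier_vec d" "X t $ j = x $ j + integral {0..t} (\<lambda>s. the (F (X s)) $ j)"
proof -
  show "X t \<in> carrier_vec d"
    using assms(1,2) unfolding flow_solution_def continuous_map_Rn_iff by auto
  have "X t = x + Matrix.vec d (\<lambda>j. integral {0..t} (\<lambda>s. the (F (X s)) $ j))"
    using assms(1,2) by (simp add: flow_solution_def)
  from arg_cong[OF this, of "\<lambda>y. y $ j"]
  show "X t $ j = x $ j + integral {0..t} (\<lambda>s. the (F (X s)) $ j)"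
    using assms(3) by simp
qed

lemma flow_solution_carrier:
  assumes "flow_solution T d F x X" "t \<in> {0..T}"
  shows "X t \<in> carrier_vec d"
  using assms unfolding flow_solution_def continuous_map_Rn_iff by auto

text \<open>The reference velocity \<open>v\<close> is free: zero yields the growth and the time
  regularity of a solution, while the value of the approximate field yields the local error of an
  Euler step.\<close>

lemma flow_increment:
  assumes X: "flow_solution T d F x X" and x: "x \<in> carrier_vec d" and v: "v \<in> carrier_vec d"
    and st: "0 \<le> s" "s \<le> t" "t \<le> T"
    and B: "B integrable_on {s..t}"
    and le: "\<And>r. r \<in> {s..t} \<Longrightarrow> vnorm (the (F (X r)) - v) \<le> B r"
  shows "vnorm (X t - X s - (t - s) \<cdot>\<^sub>v v) \<le> integral {s..t} B"
proof -
  have cont: "continuous_on {0..T} (\<lambda>r. the (F (X r)) $ j)" if "j < d" for j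
    using X that by (intro continuous_on_field) (auto simp: flow_solution_def)
  have int: "(\<lambda>r. the (F (X r)) $ j) integrable_on {p..q}" if "j < d" "0 \<le> p" "q \<le> T" for j p q
    by (rule integrable_continuous_real, rule continuous_on_subset[OF cont]) (use that in auto)
  have carr: "X r \<in> carrier_vec d" if "r \<in> {s..t}" for r
    by (rule flow_solution_carrier[OF X]) (use that st in auto)
  have eq: "(X t - X s - (t - s) \<cdot>\<^sub>v v) $ j = integral {s..t} (\<lambda>r. the (F (X r)) $ j - v $ j)"
    if j: "j < d" for j
  proof -
    have "X t $ j = x $ j + integral {0..t} (\<lambda>s. the (F (X s)) $ j)"
      "X s $ j = x $ j + integral {0..s} (\<lambda>s. the (F (X s)) $ j)"
      using flow_solutionD(2)[OF X _ j x] st by auto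
    moreover have "integral {0..s} (\<lambda>r. the (F (X r)) $ j) + integral {s..t} (\<lambda>r. the (F (X r)) $ j)
      = integral {0..t} (\<lambda>r. the (F (X r)) $ j)"
      using st j by (intro Henstock_Kurzweil_Integration.integral_combine int) auto
    moreover have "integral {s..t} (\<lambda>r. the (F (X r)) $ j - v $ j) =
      integral {s..t} (\<lambda>r. the (F (X r)) $ j) - (t - s) * v $ j"
      using st j int by (subst integral_diff) auto
    ultimately show ?thesis
      using carr[of t] carr[of s] st v j by simp
  qed
  have "vnorm (X t - X s - (t - s) \<cdot>\<^sub>v v) =
      L2_set (\<lambda>j. integral {s..t} (\<lambda>r. the (F (X r)) $ j - v $ j)) {..<d}"
    using v eq by (auto simp: vnorm_def intro!: L2_set_cong)
  also have "\<dots> \<le> integral {s..t} B"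
  proof (rule L2_set_integral_le[OF _ B])
    show "(\<lambda>r. the (F (X r)) $ j - v $ j) integrable_on {s..t}" if "j < d" for j
      using int[OF that] st by (intro integrable_diff) auto
    fix r assume r: "r \<in> {s..t}"
    have "L2_set (\<lambda>j. the (F (X r)) $ j - v $ j) {..<d} = vnorm (the (F (X r)) - v)"
      using F_carrier[OF carr[OF r]] v by (auto simp: vnorm_def intro!: L2_set_cong)
    then show "L2_set (\<lambda>j. the (F (X r)) $ j - v $ j) {..<d} \<le> B r"
      using le[OF r] by simp
  qed
  finally show ?thesis .
qed

lemma flow_solution_0:
  assumes "flow_solution T d F x X" "x \<in> carrier_vec d" "0 \<le> T"
  shows "X 0 = x"
proof (rule eq_vecI)
  have "X 0 \<in> carrier_vec d" using assms by (intro flow_solution_carrier) auto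
  then show "dim_vec (X 0) = dim_vec x" using assms(2) by simp
  show "X 0 $ j = x $ j" if "j < dim_vec x" for j
    using flow_solutionD(2)[OF assms(1), of 0 j] that assms by simp
qed

lemma flow_solution_growth:
  assumes X: "flow_solution T d F x X" and x: "x \<in> carrier_vec d" and t: "t \<in> {0..T}"
  shows "vnorm (X t) \<le> (vnorm x + T * vnorm (the (F (0\<^sub>v d)))) * exp (L * T)"
proof -
  define f0 where "f0 = vnorm (the (F (0\<^sub>v d)))"
  have contX: "continuous_map (top_of_set {0..T}) (Rn d) X"
    using X by (simp add: flow_solution_def)
  have cont': "continuous_on {0..T} (\<lambda>s. vnorm (X s - 0\<^sub>v d))"
    using contX by (rule continuous_on_vnorm_diff) simp
  have minus_0: "y - 0\<^sub>v d = y" if "y \<in> carrier_vec d" for y :: "real Matrix.vec"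
    using that by (intro eq_vecI) auto
  have cont: "continuous_on {0..T} (\<lambda>s. vnorm (X s))"
    by (rule continuous_on_eq[OF cont']) (simp only: minus_0 flow_solution_carrier[OF X])
  have "vnorm (X t) \<le> (vnorm x + T * f0) * exp (L * t)"
  proof (rule Gronwall[OF cont _ L t])
    fix s assume s: "s \<in> {0..T}"
    have int: "(\<lambda>s. vnorm (X s)) integrable_on {0..s}"
      by (rule integrable_continuous_real, rule continuous_on_subset[OF cont]) (use s in auto)
    have "vnorm (X s - X 0 - (s - 0) \<cdot>\<^sub>v 0\<^sub>v d) \<le> integral {0..s} (\<lambda>r. f0 + L * vnorm (X r))"
    proof (rule flow_increment[OF X x])
      show "(\<lambda>r. f0 + L * vnorm (X r)) integrable_on {0..s}"
        using int by (intro integrable_add integrable_on_mult_right) auto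
      fix r assume r: "r \<in> {0..s}"
      then have "X r \<in> carrier_vec d" using s by (intro flow_solution_carrier[OF X]) auto
      then show "vnorm (the (F (X r)) - 0\<^sub>v d) \<le> f0 + L * vnorm (X r)"
        using F_growth F_carrier minus_0 by (simp add: f0_def)
    qed (use s in auto)
    also have "\<dots> = s * f0 + L * integral {0..s} (\<lambda>r. vnorm (X r))"
      using s int by (subst integral_add) (auto intro!: integrable_on_mult_right)
    also have "X s - X 0 - (s - 0) \<cdot>\<^sub>v 0\<^sub>v d = X s - x"
      using flow_solution_0[OF X x] s x flow_solution_carrier[OF X s] by (intro eq_vecI) auto
    finally have "vnorm (X s - x) \<le> T * f0 + L * integral {0..s} (\<lambda>r. vnorm (X r))"
      using s mult_right_mono[of s T f0] by (simp add: f0_def)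
    then show "vnorm (X s) \<le> vnorm x + T * f0 + L * integral {0..s} (\<lambda>r. vnorm (X r))"
      using vnorm_le_add_diff[OF flow_solution_carrier[OF X s] x] by linarith
  qed
  also have "\<dots> \<le> (vnorm x + T * f0) * exp (L * T)"
    using t L by (intro mult_left_mono) (auto simp: f0_def intro!: mult_left_mono)
  finally show ?thesis by (simp add: f0_def)
qed

text \<open>Gronwall for the distance of two solutions. Equal initial values give uniqueness, and
  the time \<open>T\<close> gives the Lipschitz dependence of the flow on its initial value.\<close>

lemma flow_solution_lipschitz:
  assumes X: "flow_solution T d F x X" and x: "x \<in> carrier_vec d"
    and Y: "flow_solution T d F y Y" and y: "y \<in> carrier_vec d" and t: "t \<in> {0..T}"
  shows "vnorm (X t - Y t) \<le> vnorm (x - y) * exp (L * t)"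
proof (rule Gronwall[OF _ _ L t])
  have contX: "continuous_map (top_of_set {0..T}) (Rn d) X"
    and contY: "continuous_map (top_of_set {0..T}) (Rn d) Y"
    using X Y by (simp_all add: flow_solution_def)
  show cont: "continuous_on {0..T} (\<lambda>s. vnorm (X s - Y s))"
    using contX contY by (rule continuous_on_vnorm_diff)
  fix s assume s: "s \<in> {0..T}"
  have int: "(\<lambda>r. the (F (Z r)) $ j) integrable_on {0..s}"
    if "j < d" "continuous_map (top_of_set {0..T}) (Rn d) Z" for j Z
    by (rule integrable_continuous_real,
        rule continuous_on_subset[OF continuous_on_field[OF that(2,1)]]) (use s in auto)
  have eq: "(X s - Y s - (x - y)) $ j = integral {0..s} (\<lambda>r. the (F (X r)) $ j - the (F (Y r)) $ j)"
    if j: "j < d" for j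
    using flow_solutionD[OF X s j x] flow_solutionD[OF Y s j y] x y j int[OF j contX] int[OF j contY]
    by (simp add: integral_diff)
  have int': "(\<lambda>r. vnorm (X r - Y r)) integrable_on {0..s}"
    by (rule integrable_continuous_real, rule continuous_on_subset[OF cont]) (use s in auto)
  have "vnorm (X s - Y s - (x - y)) =
      L2_set (\<lambda>j. integral {0..s} (\<lambda>r. the (F (X r)) $ j - the (F (Y r)) $ j)) {..<d}"
    using x y eq by (auto simp: vnorm_def intro!: L2_set_cong)
  also have "\<dots> \<le> integral {0..s} (\<lambda>r. L * vnorm (X r - Y r))"
  proof (rule L2_set_integral_le)
    show "(\<lambda>r. the (F (X r)) $ j - the (F (Y r)) $ j) integrable_on {0..s}" if "j < d" for j
      using int[OF that contX] int[OF that contY] by (rule integrable_diff)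
    show "(\<lambda>r. L * vnorm (X r - Y r)) integrable_on {0..s}"
      using int' by (rule integrable_on_mult_right)
    fix r assume r: "r \<in> {0..s}"
    have c: "X r \<in> carrier_vec d" "Y r \<in> carrier_vec d"
      using flow_solution_carrier[OF X] flow_solution_carrier[OF Y] r s by auto
    have "L2_set (\<lambda>j. the (F (X r)) $ j - the (F (Y r)) $ j) {..<d} = vnorm (the (F (X r)) - the (F (Y r)))"
      using F_carrier[OF c(1)] F_carrier[OF c(2)] by (auto simp: vnorm_def intro!: L2_set_cong)
    then show "L2_set (\<lambda>j. the (F (X r)) $ j - the (F (Y r)) $ j) {..<d} \<le> L * vnorm (X r - Y r)"
      using lipschitz[OF c] by simp
  qed
  also have "\<dots> = L * integral {0..s} (\<lambda>r. vnorm (X r - Y r))"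
    by simp
  finally have "vnorm (X s - Y s - (x - y)) \<le> L * integral {0..s} (\<lambda>r. vnorm (X r - Y r))" .
  then show "vnorm (X s - Y s) \<le> vnorm (x - y) + L * integral {0..s} (\<lambda>r. vnorm (X r - Y r))"
    using vnorm_le_add_diff[of "X s - Y s" d "x - y"] x y
      flow_solution_carrier[OF X s] flow_solution_carrier[OF Y s] by auto
qed

text \<open>
  Picard's contraction for the unknown \<open>exp (- \<nu> t) * X t $ j\<close>, as a bounded continuous function
  of \<open>(j, t)\<close>. The exponential weight makes it a contraction on the whole interval at once.
\<close>

lemma flow_solution_exists:
  assumes x: "x \<in> carrier_vec d" and T: "0 \<le> T"
  shows "\<exists>X. flow_solution T d F x X"
proof -
  \<comment> \<open>Integrating exp(\<nu> s) produces a factor 1/\<nu>, and bounding the Euclidean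
    norm by a sum of \<open>d\<close> coordinates produces \<open>d\<close>; this choice makes L d /
    \<nu> at most 1/2. The summand 1 keeps \<nu> positive.\<close>
  define \<nu> where "\<nu> = 2 * (L * d) + 1"
  have \<nu>: "\<nu> > 0" using L by (simp add: \<nu>_def add_nonneg_pos)
  \<comment> \<open>The curve encoded by \<open>Z\<close>, with the weight removed. The discrete
    topology on the indices makes continuity in (j, t) mean continuity in t for each j.\<close>
  define V where "V Z t = Matrix.vec d (\<lambda>j. exp (\<nu> * t) * apply_bcontfun Z (discrete j, t))"
    for Z :: "(nat discrete \<times> real) \<Rightarrow>\<^sub>C real" and t
  have V_carrier: "V Z t \<in> carrier_vec d" for Z t by (simp add: V_def)
  have V_cont: "continuous_map (top_of_set {0..T}) (Rn d) (V Z)" for Z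
  proof -
    have "continuous_on {0..T} (\<lambda>t. exp (\<nu> * t) * apply_bcontfun Z (discrete j, t))" for j
      by (intro continuous_intros continuous_on_compose2[OF continuous_on_apply_bcontfun[of UNIV Z]]) auto
    then show ?thesis by (auto simp: continuous_map_Rn_iff V_def)
  qed
  have FV_cont: "continuous_on {0..T} (\<lambda>s. the (F (V Z s)) $ j)" if "j < d" for Z j
    using V_cont that by (rule continuous_on_field)
  define q where "q Z j t = exp (- \<nu> * t) * (x $ j + integral {0..t} (\<lambda>s. the (F (V Z s)) $ j))"
    for Z j t
  have q_cont: "continuous_on {0..T} (q Z j)" if "j < d" for Z j
    unfolding q_def
    by (intro continuous_intros indefinite_integral_continuous_1 integrable_continuous_real
        FV_cont[OF that])
  \<comment> \<open>Elements of the function space live on the whole real line; outside [0, T] the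
    Picard image is frozen at its boundary values, which keeps it continuous and bounded.\<close>
  define clamp where "clamp t = max 0 (min T t)" for t :: real
  have clamp: "clamp t \<in> {0..T}" for t using T by (simp add: clamp_def)
  define P where "P Z = (\<lambda>(k, t). let j = of_discrete k in if j < d then q Z j (clamp t) else 0)" for Z
  have P: "P Z (discrete j, t) = (if j < d then q Z j (clamp t) else 0)" for Z j t
    by (simp add: P_def discrete_inverse)
  have ex_discrete: "\<exists>j. k = discrete j" for k :: "nat discrete"
    by (metis of_discrete_inverse)
  have P_bcont: "P Z \<in> bcontfun" for Z
    unfolding bcontfun_def
  proof (intro CollectI conjI)
    have c: "continuous_on UNIV (\<lambda>t. P Z (discrete j, t))" for j
    proof (cases "j < d")
      case True
      have "continuous_on UNIV (\<lambda>t. q Z j (clamp t))"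
        by (rule continuous_on_compose2[OF q_cont[OF True]])
           (use clamp in \<open>auto simp: clamp_def intro!: continuous_intros\<close>)
      with True show ?thesis by (simp add: P)
    qed (simp add: P)
    show "continuous_on UNIV (P Z)"
    proof (subst continuous_on_open_vimage, simp, intro allI impI)
      fix B :: "real set" assume "open B"
      \<comment> \<open>The index space is discrete, so the preimage is open as soon as each of its
        slices is.\<close>
      have "P Z -` B = (\<Union>j. {discrete j} \<times> ((\<lambda>t. P Z (discrete j, t)) -` B))"
      proof (intro equalityI subsetI)
        fix p assume "p \<in> P Z -` B"
        moreover obtain j t where "p = (discrete j, t)" using ex_discrete by (cases p) blast
        ultimately show "p \<in> (\<Union>j. {discrete j} \<times> ((\<lambda>t. P Z (discrete j, t)) -` B))" by blast
      qed auto
      moreover have "open ((\<lambda>t. P Z (discrete j, t)) -` B)" for j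
        using c[of j] \<open>open B\<close> by (simp add: continuous_on_open_vimage)
      ultimately show "open (P Z -` B \<inter> UNIV)"
        by (auto intro!: open_UN open_Times open_discrete)
    qed
    have "bounded (\<Union>j<d. q Z j ` {0..T})"
      by (intro bounded_UN) (auto intro!: compact_imp_bounded compact_continuous_image q_cont)
    moreover have "P Z (discrete j, t) \<in> insert 0 (\<Union>j<d. q Z j ` {0..T})" for j t
    proof (cases "j < d")
      case True
      then have "P Z (discrete j, t) = q Z j (clamp t)" "j \<in> {..<d}" by (simp_all add: P)
      then show ?thesis using clamp[of t] by blast
    qed (simp add: P)
    then have "P Z p \<in> insert 0 (\<Union>j<d. q Z j ` {0..T})" for p
      using ex_discrete[of "fst p"] by (metis prod.collapse)
    then have "range (P Z) \<subseteq> insert 0 (\<Union>j<d. q Z j ` {0..T})"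
      by blast
    ultimately show "bounded (range (P Z))"
      using bounded_subset[of "insert 0 (\<Union>j<d. q Z j ` {0..T})"] by simp
  qed
  define Pc where "Pc Z = Bcontfun (P Z)" for Z
  have Pc: "apply_bcontfun (Pc Z) = P Z" for Z
    unfolding Pc_def by (rule Bcontfun_inverse[OF P_bcont])
  have contraction: "dist (Pc Z) (Pc Z') \<le> 1 / 2 * dist Z Z'" for Z Z'
  proof (rule dist_bound)
    fix p :: "nat discrete \<times> real"
    obtain j t where p: "p = (discrete j, t)" using ex_discrete by (cases p) blast
    define D where "D = dist Z Z'"
    show "dist (apply_bcontfun (Pc Z) p) (apply_bcontfun (Pc Z') p) \<le> 1 / 2 * D"
    proof (cases "j < d")
      case j: True
      define \<tau> where "\<tau> = clamp t"
      have \<tau>: "\<tau> \<in> {0..T}" using clamp by (simp add: \<tau>_def)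
      have int: "(\<lambda>s. the (F (V Z s)) $ j) integrable_on {0..\<tau>}" for Z
        by (rule integrable_continuous_real, rule continuous_on_subset[OF FV_cont[OF j]]) (use \<tau> in auto)
      have "((\<lambda>s. L * d * D * exp (\<nu> * s)) has_integral
          (L * d * D / \<nu> * exp (\<nu> * \<tau>) - L * d * D / \<nu> * exp (\<nu> * 0))) {0..\<tau>}"
        using \<nu> \<tau>
        by (intro fundamental_theorem_of_calculus)
           (auto intro!: derivative_eq_intros simp flip: has_real_derivative_iff_has_vector_derivative)
      note has_int = this
      have "\<bar>the (F (V Z s)) $ j - the (F (V Z' s)) $ j\<bar> \<le> L * d * D * exp (\<nu> * s)" for s
      proof -
        have "vnorm (V Z s - V Z' s) \<le> (\<Sum>k<d. \<bar>(V Z s - V Z' s) $ k\<bar>)"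
          by (rule vnorm_le_sum_abs) (use V_carrier in auto)
        also have "\<dots> \<le> (\<Sum>k<d. exp (\<nu> * s) * D)"
        proof (rule sum_mono)
          fix k assume k: "k \<in> {..<d}"
          have "\<bar>(V Z s - V Z' s) $ k\<bar> = exp (\<nu> * s) * dist (apply_bcontfun Z (discrete k, s)) (apply_bcontfun Z' (discrete k, s))"
            using k by (simp add: V_def dist_real_def abs_mult flip: right_diff_distrib)
          also have "\<dots> \<le> exp (\<nu> * s) * D"
            unfolding D_def by (intro mult_left_mono dist_bounded) auto
          finally show "\<bar>(V Z s - V Z' s) $ k\<bar> \<le> exp (\<nu> * s) * D" .
        qed
        finally have *: "L * vnorm (V Z s - V Z' s) \<le> L * (\<Sum>k<d. exp (\<nu> * s) * D)"
          using L by (rule mult_left_mono)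
        have "\<bar>the (F (V Z s)) $ j - the (F (V Z' s)) $ j\<bar> \<le> vnorm (the (F (V Z s)) - the (F (V Z' s)))"
          using abs_index_le_vnorm[of "the (F (V Z s)) - the (F (V Z' s))" d j]
            F_carrier[OF V_carrier] j by (auto simp: carrier_vecD[OF F_carrier[OF V_carrier]])
        also have "\<dots> \<le> L * vnorm (V Z s - V Z' s)"
          by (rule lipschitz[OF V_carrier V_carrier])
        finally show ?thesis
          using * by (simp add: ac_simps)
      qed
      then have "norm (integral {0..\<tau>} (\<lambda>s. the (F (V Z s)) $ j - the (F (V Z' s)) $ j))
          \<le> integral {0..\<tau>} (\<lambda>s. L * d * D * exp (\<nu> * s))"
        using has_int by (intro integral_norm_bound_integral integrable_diff int) auto
      also have "\<dots> = L * d * D / \<nu> * exp (\<nu> * \<tau>) - L * d * D / \<nu>"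
        using integral_unique[OF has_int] by simp
      \<comment> \<open>After dropping the contribution at time 0, the remaining exponential is
        exactly the one cancelled by the weight, uniformly in time.\<close>
      also have "\<dots> \<le> L * d * D / \<nu> * exp (\<nu> * \<tau>)"
        using L \<nu> by (simp add: D_def)
      finally have le: "\<bar>integral {0..\<tau>} (\<lambda>s. the (F (V Z s)) $ j - the (F (V Z' s)) $ j)\<bar>
        \<le> L * d * D / \<nu> * exp (\<nu> * \<tau>)" by simp
      have "dist (apply_bcontfun (Pc Z) p) (apply_bcontfun (Pc Z') p) = \<bar>q Z j \<tau> - q Z' j \<tau>\<bar>"
        using j p by (simp add: Pc P \<tau>_def dist_real_def)
      also have "q Z j \<tau> - q Z' j \<tau> =
        exp (- \<nu> * \<tau>) * integral {0..\<tau>} (\<lambda>s. the (F (V Z s)) $ j - the (F (V Z' s)) $ j)"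
        by (simp add: q_def integral_diff[OF int int] algebra_simps)
      also have "\<bar>\<dots>\<bar> \<le> exp (- \<nu> * \<tau>) * (L * d * D / \<nu> * exp (\<nu> * \<tau>))"
        unfolding abs_mult abs_exp_cancel using le by (rule mult_left_mono) simp
      also have "\<dots> = L * d / \<nu> * D"
        by (simp add: exp_minus)
      also have "\<dots> \<le> 1 / 2 * D"
        using L \<nu> by (intro mult_right_mono) (auto simp: D_def \<nu>_def divide_simps)
      finally show ?thesis .
    qed (simp add: Pc P p D_def)
  qed
  obtain Z where Z: "Pc Z = Z"
    using banach_fix_type[of "1 / 2" Pc] contraction by auto
  have "flow_solution T d F x (V Z)"
    unfolding flow_solution_def
  proof (intro conjI V_cont ballI)
    fix t assume t: "t \<in> {0..T}"
    show "V Z t = x + Matrix.vec d (\<lambda>j. integral {0..t} (\<lambda>s. the (F (V Z s)) $ j))"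
    proof (rule eq_vecI)
      fix j assume "j < dim_vec (x + Matrix.vec d (\<lambda>j. integral {0..t} (\<lambda>s. the (F (V Z s)) $ j)))"
      then have j: "j < d" by simp
      \<comment> \<open>On [0, T] the freezing has no effect, so the fixed point satisfies the
        integral equation there.\<close>
      have "clamp t = t" using t by (simp add: clamp_def)
      have "V Z t $ j = exp (\<nu> * t) * apply_bcontfun (Pc Z) (discrete j, t)"
        using j by (simp add: V_def Z)
      also have "\<dots> = exp (\<nu> * t) * q Z j t"
        using j \<open>clamp t = t\<close> by (simp add: Pc P)
      also have "\<dots> = x $ j + integral {0..t} (\<lambda>s. the (F (V Z s)) $ j)"
        by (simp add: q_def exp_minus)
      finally show "V Z t $ j = (x + Matrix.vec d (\<lambda>j. integral {0..t} (\<lambda>s. the (F (V Z s)) $ j))) $ j"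
        using j by simp
    qed (simp add: V_def)
  qed
  then show ?thesis by blast
qed

text \<open>Two solutions with the same initial value have distance at most 0 by the Lipschitz
  estimate, so the description in \<open>flow_value\<close> has a unique witness.\<close>

lemma flow_value_eq:
  assumes X: "flow_solution T d F x X" and x: "x \<in> carrier_vec d" and T: "0 \<le> T"
  shows "flow_value T d F x = X T"
  unfolding flow_value_def
proof (rule the_equality)
  fix y assume "\<exists>Y. flow_solution T d F x Y \<and> y = Y T"
  then obtain Y where Y: "flow_solution T d F x Y" "y = Y T" by blast
  have "vnorm (Y T - X T) \<le> vnorm (x - x) * exp (L * T)"
    using flow_solution_lipschitz[OF Y(1) x X x, of T] T by simp
  then have "Y T = X T"
    using flow_solution_carrier[OF X, of T] flow_solution_carrier[OF Y(1), of T] T x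
    by (intro vnorm_zero_imp_eq[of _ d]) auto
  with Y show "y = X T" by simp
qed (use X in blast)

lemma flow_value_carrier:
  assumes "x \<in> carrier_vec d" "0 \<le> T"
  shows "flow_value T d F x \<in> carrier_vec d"
proof -
  obtain X where X: "flow_solution T d F x X"
    using flow_solution_exists[OF assms] by blast
  show ?thesis
    using flow_value_eq[OF X assms] flow_solution_carrier[OF X, of T] assms by simp
qed

lemma flow_value_lipschitz:
  assumes "x \<in> carrier_vec d" "y \<in> carrier_vec d" "0 \<le> T"
  shows "vnorm (flow_value T d F x - flow_value T d F y) \<le> exp (L * T) * vnorm (x - y)"
proof -
  obtain X Y where "flow_solution T d F x X" "flow_solution T d F y Y"
    using flow_solution_exists assms by meson
  then show ?thesis
    using flow_solution_lipschitz[of T x X y Y T] assms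
    by (simp add: flow_value_eq mult.commute)
qed

end

section \<open>The perturbed Euler scheme\<close>

context lipschitz_field
begin

text \<open>Within a step, the true velocity and the one used differ by at most
  \<open>L * h * M\<close> for the motion of the solution, \<open>L\<close> times the error so far,
  and \<open>\<eta>\<close> for the error of \<open>\<phi>\<close>. The last is measured at the
  iterates, whose size can be controlled separately.\<close>

lemma euler_error:
  fixes \<phi> :: "real Matrix.vec \<Rightarrow> real Matrix.vec"
  assumes x: "x \<in> carrier_vec d" and T: "0 \<le> T" and n: "0 < n"
    and \<phi>: "\<And>y. y \<in> carrier_vec d \<Longrightarrow> \<phi> y \<in> carrier_vec d"
  defines "h \<equiv> T / real n"
  defines "Y \<equiv> \<lambda>k. ((\<lambda>y. y + h \<cdot>\<^sub>v \<phi> y) ^^ k) x"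
  defines "f0 \<equiv> vnorm (the (F (0\<^sub>v d)))"
  assumes \<eta>: "\<And>k. k < n \<Longrightarrow> vnorm (the (F (Y k)) - \<phi> (Y k)) \<le> \<eta>"
  shows "vnorm (flow_value T d F x - Y n)
    \<le> T * exp (L * T) * (L * h * (f0 + L * ((vnorm x + T * f0) * exp (L * T))) + \<eta>)"
proof -
  \<comment> \<open>\<open>M\<close> bounds the speed of the exact solution on [0, T], and
    \<open>b\<close> is the new error per unit of time.\<close>
  define M where "M = f0 + L * ((vnorm x + T * f0) * exp (L * T))"
  define b where "b = L * h * M + \<eta>"
  obtain X where X: "flow_solution T d F x X"
    using flow_solution_exists[OF x T] by blast
  have h: "0 \<le> h" "real n * h = T" using T n by (simp_all add: h_def)
  have f0: "0 \<le> f0" by (simp add: f0_def)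
  have M: "0 \<le> M" using f0 L T by (simp add: M_def)
  \<comment> \<open>The iterate with index 0, available since \<open>n\<close> is positive, fixes
    the sign of \<open>\<eta>\<close>.\<close>
  have "0 \<le> \<eta>" using order_trans[OF vnorm_nonneg \<eta>[OF n]] .
  then have b: "0 \<le> b" using L h M by (simp add: b_def)
  have Y: "Y k \<in> carrier_vec d" for k
    using x \<phi> by (induction k) (auto simp: Y_def)
  have X_carrier: "X t \<in> carrier_vec d" if "t \<in> {0..T}" for t
    using flow_solution_carrier[OF X that] .
  have minus_0: "y - 0\<^sub>v d = y" if "y \<in> carrier_vec d" for y :: "real Matrix.vec"
    using that by (intro eq_vecI) auto
  have FX: "vnorm (the (F (X t))) \<le> M" if t: "t \<in> {0..T}" for t
    using F_growth[OF X_carrier[OF t]] mult_left_mono[OF flow_solution_growth[OF X x t] L]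
    by (simp add: M_def f0_def)
  have Xs: "vnorm (X t - X s) \<le> (t - s) * M" if "0 \<le> s" "s \<le> t" "t \<le> T" for s t
  proof -
    have "vnorm (X t - X s - (t - s) \<cdot>\<^sub>v 0\<^sub>v d) \<le> integral {s..t} (\<lambda>_. M)"
      using that by (intro flow_increment[OF X x]) (auto simp: minus_0 F_carrier X_carrier FX)
    moreover have "X t - X s - (t - s) \<cdot>\<^sub>v 0\<^sub>v d = X t - X s"
      using that X_carrier[of t] X_carrier[of s] by (intro eq_vecI) auto
    ultimately show ?thesis using that by simp
  qed
  \<comment> \<open>A discrete Gronwall estimate: after \<open>k\<close> steps the accumulated
    defects \<open>real k * h * b\<close> have been amplified by at most
    \<open>(1 + h * L) ^ k\<close>.\<close>
  have "vnorm (X (real k * h) - Y k) \<le> real k * h * b * (1 + h * L) ^ k" if "k \<le> n" for k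
    using that
  proof (induction k)
    case 0
    have "X 0 - x = 0\<^sub>v d"
      using flow_solution_0[OF X x T] x by (intro eq_vecI) auto
    then show ?case by (simp add: Y_def)
  next
    case (Suc k)
    define s t where "s = real k * h" and "t = real (Suc k) * h"
    have "t \<le> real n * h"
      unfolding t_def using Suc.prems h by (intro mult_right_mono) auto
    then have st: "0 \<le> s" "s \<le> t" "t \<le> T" "t - s = h"
      using h by (auto simp: s_def t_def algebra_simps)
    have Xst: "X s \<in> carrier_vec d" "X t \<in> carrier_vec d" using st by (auto intro: X_carrier)
    have \<phi>Y: "\<phi> (Y k) \<in> carrier_vec d" using \<phi> Y by simp
    define e where "e = vnorm (X s - Y k)"
    have "vnorm (X t - X s - (t - s) \<cdot>\<^sub>v \<phi> (Y k)) \<le> integral {s..t} (\<lambda>_. b + L * e)"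
    proof (rule flow_increment[OF X x \<phi>Y st(1-3)])
      fix r assume r: "r \<in> {s..t}"
      have Xr: "X r \<in> carrier_vec d" using r st by (auto intro: X_carrier)
      have "vnorm (X r - X s) \<le> (r - s) * M" using r st by (intro Xs) auto
      also have "\<dots> \<le> h * M" using r st M by (intro mult_right_mono) auto
      finally have "L * vnorm (X r - X s) \<le> L * (h * M)" using L by (rule mult_left_mono)
      then have 1: "vnorm (the (F (X r)) - the (F (X s))) \<le> L * (h * M)"
        using lipschitz[OF Xr Xst(1)] by linarith
      have "vnorm (the (F (X r)) - \<phi> (Y k)) \<le>
        vnorm (the (F (X r)) - the (F (X s))) + vnorm (the (F (X s)) - \<phi> (Y k))"
        using Xr Xst \<phi>Y by (intro vnorm_triangle[of _ d] F_carrier)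
      also have "vnorm (the (F (X s)) - \<phi> (Y k)) \<le>
        vnorm (the (F (X s)) - the (F (Y k))) + vnorm (the (F (Y k)) - \<phi> (Y k))"
        using Xst \<phi>Y Y by (intro vnorm_triangle[of _ d] F_carrier)
      finally show "vnorm (the (F (X r)) - \<phi> (Y k)) \<le> b + L * e"
        using 1 lipschitz[OF Xst(1) Y[of k]] \<eta>[of k] Suc.prems by (simp add: b_def e_def)
    qed auto
    then have incr: "vnorm (X t - X s - h \<cdot>\<^sub>v \<phi> (Y k)) \<le> h * (b + L * e)"
      using st by simp
    have "X t - Y (Suc k) = (X s - Y k) + (X t - X s - h \<cdot>\<^sub>v \<phi> (Y k))"
      using Xst Y[of k] \<phi>Y by (intro eq_vecI) (auto simp: Y_def)
    then have "vnorm (X t - Y (Suc k)) \<le> e + vnorm (X t - X s - h \<cdot>\<^sub>v \<phi> (Y k))"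
      using vnorm_add_le[of "X s - Y k" d "X t - X s - h \<cdot>\<^sub>v \<phi> (Y k)"] Xst Y[of k] \<phi>Y
      by (simp add: e_def)
    also have "\<dots> \<le> (1 + h * L) * e + h * b"
      using incr by (simp add: algebra_simps)
    also have "\<dots> \<le> (1 + h * L) * (real k * h * b * (1 + h * L) ^ k) + h * b * (1 + h * L) ^ Suc k"
    proof (intro add_mono mult_left_mono)
      show "e \<le> real k * h * b * (1 + h * L) ^ k"
        using Suc by (simp add: e_def s_def)
      show "h * b \<le> h * b * (1 + h * L) ^ Suc k"
        using mult_left_mono[OF one_le_power[of "1 + h * L" "Suc k"], of "h * b"] h b L by simp
    qed (use h L in auto)
    also have "\<dots> = real (Suc k) * h * b * (1 + h * L) ^ Suc k"
      by (simp add: algebra_simps)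
    finally show ?case by (simp add: t_def)
  qed
  from this[of n] have "vnorm (X T - Y n) \<le> T * b * (1 + h * L) ^ n"
    using h(2) by simp
  also have "(1 + h * L) ^ n \<le> exp (h * L) ^ n"
    using h L by (intro power_mono exp_ge_add_one_self) auto
  also have "exp (h * L) ^ n = exp (L * T)"
    using h(2) by (simp add: ac_simps flip: exp_of_nat_mult)
  finally have "vnorm (X T - Y n) \<le> T * b * exp (L * T)"
    using T b by (simp add: mult_left_mono)
  then show ?thesis
    using flow_value_eq[OF X x T] by (simp add: b_def M_def ac_simps)
qed

text \<open>Adding \<open>H\<close> makes the growth bound homogeneous:
  \<open>vnorm (Y k) + H\<close> grows by at most the factor \<open>1 + h * L\<close> per step, so
  the result does not depend on the number of steps.\<close>

lemma euler_growth:
  fixes \<phi> :: "real Matrix.vec \<Rightarrow> real Matrix.vec"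
  assumes x: "x \<in> carrier_vec d" and T: "0 \<le> T" and n: "0 < n" and H: "0 \<le> H"
    and \<phi>: "\<And>y. y \<in> carrier_vec d \<Longrightarrow> \<phi> y \<in> carrier_vec d"
    and growth: "\<And>y. y \<in> carrier_vec d \<Longrightarrow> vnorm (\<phi> y) \<le> L * (H + vnorm y)"
    and k: "k \<le> n"
  defines "h \<equiv> T / real n"
  defines "Y \<equiv> \<lambda>k. ((\<lambda>y. y + h \<cdot>\<^sub>v \<phi> y) ^^ k) x"
  shows "Y k \<in> carrier_vec d" "vnorm (Y k) \<le> exp (L * T) * (vnorm x + H)"
proof -
  have h: "0 \<le> h" "real n * h = T" using T n by (simp_all add: h_def)
  have Y: "Y k \<in> carrier_vec d" for k
    using x \<phi> by (induction k) (auto simp: Y_def)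
  then show "Y k \<in> carrier_vec d" .
  have "vnorm (Y k) + H \<le> (1 + h * L) ^ k * (vnorm x + H)" for k
  proof (induction k)
    case (Suc k)
    have "vnorm (Y (Suc k)) \<le> vnorm (Y k) + vnorm (h \<cdot>\<^sub>v \<phi> (Y k))"
      using vnorm_add_le[OF Y[of k], of "h \<cdot>\<^sub>v \<phi> (Y k)"] \<phi>[OF Y] by (simp add: Y_def)
    also have "vnorm (h \<cdot>\<^sub>v \<phi> (Y k)) \<le> h * (L * (H + vnorm (Y k)))"
      using h growth[OF Y] by (auto simp: vnorm_smult intro: mult_left_mono)
    finally have "vnorm (Y (Suc k)) + H \<le> (1 + h * L) * (vnorm (Y k) + H)"
      by (simp add: algebra_simps)
    also have "\<dots> \<le> (1 + h * L) * ((1 + h * L) ^ k * (vnorm x + H))"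
      using Suc h L by (intro mult_left_mono) auto
    finally show ?case by (simp add: ac_simps)
  qed (simp add: Y_def)
  then have "vnorm (Y k) \<le> (1 + h * L) ^ k * (vnorm x + H)"
    using H by (smt (verit))
  also have "(1 + h * L) ^ k \<le> (1 + h * L) ^ n"
    using h L k by (intro power_increasing) auto
  also have "(1 + h * L) ^ n \<le> exp (h * L) ^ n"
    using h L by (intro power_mono exp_ge_add_one_self) auto
  also have "exp (h * L) ^ n = exp (L * T)"
    using h(2) by (simp add: ac_simps flip: exp_of_nat_mult)
  finally show "vnorm (Y k) \<le> exp (L * T) * (vnorm x + H)"
    using H by (simp add: mult_right_mono)
qed

text \<open>All network errors are evaluated at Euler iterates, where the growth bound turns the
  weighted estimates into one number \<open>\<eta>\<close>. It enters through the scheme, multiplied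
  by the Lipschitz constant of \<open>G\<close>, and once more through \<open>\<gamma>\<close> at
  the final iterate.\<close>

lemma flow_approx_error:
  fixes \<phi> \<gamma> G :: "real Matrix.vec \<Rightarrow> real Matrix.vec"
  assumes x: "x \<in> carrier_vec d" and T: "0 \<le> T" and n: "0 < n" and H: "0 \<le> H"
    and \<kappa>: "0 \<le> \<kappa>" and \<delta>: "0 \<le> \<delta>"
    and \<phi>: "\<And>y. y \<in> carrier_vec d \<Longrightarrow> \<phi> y \<in> carrier_vec d"
    and \<phi>_growth: "\<And>y. y \<in> carrier_vec d \<Longrightarrow> vnorm (\<phi> y) \<le> L * (H + vnorm y)"
    and \<phi>_approx: "\<And>y. y \<in> carrier_vec d \<Longrightarrow>
      vnorm (the (F y) - \<phi> y) \<le> \<delta> * (1 + vnorm y powr \<kappa>)"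
    and G: "\<And>y. y \<in> carrier_vec d \<Longrightarrow> G y \<in> carrier_vec m"
    and G_lipschitz: "\<And>y z. \<lbrakk>y \<in> carrier_vec d; z \<in> carrier_vec d\<rbrakk> \<Longrightarrow>
      vnorm (G y - G z) \<le> L * vnorm (y - z)"
    and \<gamma>: "\<And>y. y \<in> carrier_vec d \<Longrightarrow> \<gamma> y \<in> carrier_vec m"
    and \<gamma>_approx: "\<And>y. y \<in> carrier_vec d \<Longrightarrow>
      vnorm (G y - \<gamma> y) \<le> \<delta> * (1 + vnorm y powr \<kappa>)"
  defines "h \<equiv> T / real n" and "f0 \<equiv> vnorm (the (F (0\<^sub>v d)))" and "E \<equiv> exp (L * T)"
  defines "Y \<equiv> \<lambda>k. ((\<lambda>y. y + h \<cdot>\<^sub>v \<phi> y) ^^ k) x"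
  shows "vnorm (G (flow_value T d F x) - \<gamma> (Y n)) \<le>
    L * T * E * (L * h * (f0 + L * ((vnorm x + T * f0) * E))) +
    (L * T * E + 1) * (\<delta> * (1 + (E * (vnorm x + H)) powr \<kappa>))"
proof -
  define \<eta> where "\<eta> = \<delta> * (1 + (E * (vnorm x + H)) powr \<kappa>)"
  have Y: "Y k \<in> carrier_vec d" and Y_le: "vnorm (Y k) \<le> E * (vnorm x + H)" if "k \<le> n" for k
    using euler_growth[OF x T n H \<phi> \<phi>_growth that] by (simp_all add: Y_def h_def E_def)
  have powr: "\<delta> * (1 + vnorm (Y k) powr \<kappa>) \<le> \<eta>" if "k \<le> n" for k
    unfolding \<eta>_def using Y_le[OF that] \<kappa> \<delta>
    by (intro mult_left_mono add_left_mono powr_mono2) auto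
  have "vnorm (the (F (Y k)) - \<phi> (Y k)) \<le> \<eta>" if "k < n" for k
    using \<phi>_approx[OF Y[of k]] powr[of k] that by linarith
  then have err: "vnorm (flow_value T d F x - Y n)
      \<le> T * E * (L * h * (f0 + L * ((vnorm x + T * f0) * E)) + \<eta>)"
    using euler_error[OF x T n \<phi>, where \<eta> = \<eta>] by (simp add: Y_def h_def f0_def E_def)
  have fv: "flow_value T d F x \<in> carrier_vec d"
    by (rule flow_value_carrier[OF x T])
  have "vnorm (G (flow_value T d F x) - \<gamma> (Y n)) \<le>
    vnorm (G (flow_value T d F x) - G (Y n)) + vnorm (G (Y n) - \<gamma> (Y n))"
    using fv Y by (intro vnorm_triangle[of _ m] G \<gamma>) auto
  also have "vnorm (G (flow_value T d F x) - G (Y n)) \<le> L * vnorm (flow_value T d F x - Y n)"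
    using fv Y by (intro G_lipschitz) auto
  also have "\<dots> \<le> L * (T * E * (L * h * (f0 + L * ((vnorm x + T * f0) * E)) + \<eta>))"
    using err L by (rule mult_left_mono)
  also have "vnorm (G (Y n) - \<gamma> (Y n)) \<le> \<eta>"
    using \<gamma>_approx[OF Y[of n]] powr[of n] by simp
  finally show ?thesis by (simp add: \<eta>_def algebra_simps)
qed

end

text \<open>This isolates the two parameters still to be chosen: the step size occurs only in
  \<open>h * Da\<close>, the accuracy only in \<open>\<delta> powr (1 - \<rho>) * Db\<close>. The
  other factors are the inverse weight and constants built from \<open>L\<close>, \<open>T\<close>,
  \<open>E\<close>, \<open>S\<close>, \<open>\<kappa>\<close>.\<close>

lemma flow_error_bound:
  fixes L T E S \<delta> \<rho> \<kappa> h X H f0 Da Db :: real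
  assumes nonneg: "0 \<le> L" "0 \<le> T" "0 \<le> X" "0 \<le> H" "0 \<le> f0" "0 \<le> h" "0 \<le> \<rho>"
    and ge1: "1 \<le> E" "1 \<le> S" "1 \<le> Da" "1 \<le> Db" "1 \<le> \<kappa>"
    and \<delta>: "0 < \<delta>" "\<delta> \<le> 1"
    and H: "H powr \<kappa> \<le> S * (\<delta> powr (- \<rho>) * Db)" and f0: "f0 \<le> S * Da"
  shows "L * T * E * (L * h * (f0 + L * ((X + T * f0) * E))) +
      (L * T * E + 1) * (\<delta> * (1 + (E * (X + H)) powr \<kappa>))
    \<le> (2 * (L * T * E) * L * (S * (1 + L * T * E) + L * E) * (h * Da) +
        (L * T * E + 1) * (1 + (2 * E) powr \<kappa> * S) * (\<delta> powr (1 - \<rho>) * Db)) *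
      (1 + X powr \<kappa>)"
proof -
  define C where "C = S * (1 + L * T * E) + L * E"
  define A where "A = (2 * E) powr \<kappa>"
  define q where "q = \<delta> powr (- \<rho>) * Db"
  have LTE: "0 \<le> L * T * E" and LE: "0 \<le> L * E" using nonneg ge1 by simp_all
  have A: "0 \<le> A" by (simp add: A_def)
  have X\<kappa>: "0 \<le> X powr \<kappa>" by simp
  have "1 \<le> \<delta> powr (- \<rho>)"
    using powr_mono'[of "- \<rho>" 0 \<delta>] \<delta> nonneg by simp
  then have q: "1 \<le> q"
    unfolding q_def using ge1 mult_mono[of 1 "\<delta> powr (- \<rho>)" 1 Db] by simp
  have C0: "0 \<le> C" using LTE LE ge1 by (simp add: C_def)
  \<comment> \<open>Linear growth is absorbed by the weight: above 1 the power dominates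
    \<open>X\<close> because \<kappa> is at least 1, below 1 the constant suffices.\<close>
  have X_le: "1 + X \<le> 2 * (1 + X powr \<kappa>)"
  proof (cases "X \<le> 1")
    case False
    then have "X powr 1 \<le> X powr \<kappa>" using ge1 by (intro powr_mono) auto
    then show ?thesis using False by simp
  next
    case True
    then show ?thesis using X\<kappa> by (smt (verit))
  qed
  have "f0 + L * ((X + T * f0) * E) = f0 * (1 + L * T * E) + L * E * X"
    by (simp add: algebra_simps)
  also have "\<dots> \<le> S * Da * (1 + L * T * E) + L * E * (Da * X)"
    using f0 LTE LE ge1 nonneg mult_right_mono[of 1 Da X]
    by (intro add_mono mult_right_mono mult_left_mono) auto
  also have "\<dots> \<le> C * Da * (1 + X)"
  proof -
    have "0 \<le> S * (1 + L * T * E) * Da * X" "0 \<le> L * E * Da"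
      using LTE LE ge1 nonneg by simp_all
    then show ?thesis by (simp add: C_def algebra_simps)
  qed
  also have "\<dots> \<le> C * Da * (2 * (1 + X powr \<kappa>))"
    using C0 ge1 X_le by (intro mult_left_mono) auto
  finally have "L * T * E * (L * h * (f0 + L * ((X + T * f0) * E)))
      \<le> L * T * E * (L * h * (C * Da * (2 * (1 + X powr \<kappa>))))"
    using LTE nonneg by (intro mult_left_mono) auto
  then have 1: "L * T * E * (L * h * (f0 + L * ((X + T * f0) * E)))
      \<le> 2 * (L * T * E) * L * C * (h * Da) * (1 + X powr \<kappa>)"
    by (simp add: ac_simps)
  \<comment> \<open>Passing to twice the maximum splits the power of the sum, with the constant
    2^\<kappa> going into \<open>A\<close>.\<close>
  have "E * (X + H) \<le> 2 * E * max X H"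
    using ge1 by (simp add: mult_left_mono)
  then have "(E * (X + H)) powr \<kappa> \<le> (2 * E * max X H) powr \<kappa>"
    using nonneg ge1 by (intro powr_mono2) auto
  also have "\<dots> = A * max X H powr \<kappa>"
    using nonneg ge1 by (simp add: A_def powr_mult)
  also have "\<dots> \<le> A * (X powr \<kappa> + H powr \<kappa>)"
    using A by (intro mult_left_mono) (auto simp: max_def)
  also have "\<dots> \<le> A * (X powr \<kappa> + S * q)"
    using A H by (intro mult_left_mono) (auto simp: q_def)
  finally have "1 + (E * (X + H)) powr \<kappa> \<le> 1 + A * X powr \<kappa> + A * S * q"
    by (simp add: algebra_simps)
  \<comment> \<open>Since \<open>q\<close> and \<open>S\<close> are at least 1, every summand is
    dominated by a term of the expanded product.\<close>
  also have "\<dots> \<le> q * (1 + A * S) * (1 + X powr \<kappa>)"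
  proof -
    have "1 * (A * X powr \<kappa>) \<le> (q * S) * (A * X powr \<kappa>)"
      using q ge1 A X\<kappa> mult_mono[of 1 q 1 S] by (intro mult_right_mono) auto
    moreover have "0 \<le> q * X powr \<kappa>" using q by simp
    moreover have "q * (1 + A * S) * (1 + X powr \<kappa>) =
      q + q * X powr \<kappa> + A * S * q + (q * S) * (A * X powr \<kappa>)"
      by (simp add: algebra_simps)
    ultimately show ?thesis using q by linarith
  qed
  finally have "\<delta> * (1 + (E * (X + H)) powr \<kappa>) \<le> \<delta> * (q * (1 + A * S) * (1 + X powr \<kappa>))"
    using \<delta> by (intro mult_left_mono) auto
  \<comment> \<open>The factor \<delta> meets the \<delta>^(-\<rho>) inside \<open>q\<close>, which
    produces the exponent 1 - \<rho>.\<close>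
  also have "\<dots> = (1 + A * S) * (\<delta> powr (1 - \<rho>) * Db) * (1 + X powr \<kappa>)"
    using \<delta> by (simp add: q_def powr_diff powr_minus field_simps)
  finally have "(L * T * E + 1) * (\<delta> * (1 + (E * (X + H)) powr \<kappa>))
      \<le> (L * T * E + 1) * ((1 + A * S) * (\<delta> powr (1 - \<rho>) * Db) * (1 + X powr \<kappa>))"
    using LTE by (intro mult_left_mono) auto
  with 1 show ?thesis
    unfolding C_def[symmetric] A_def[symmetric] by (simp add: algebra_simps)
qed

section \<open>Continuity of the flow and of the composed family\<close>

context lipschitz_field
begin

lemma flow_value_continuous:
  assumes T: "0 \<le> T"
  shows "continuous_map (Rn d) (Rn d) (flow_value T d F)"
proof -
  interpret M: Metric_space "carrier_vec d" "vdist d" by (rule Metric_space_vdist)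
  show ?thesis
    unfolding Rn_def M.metric_continuous_map[OF Metric_space_vdist]
  proof (intro conjI ballI allI impI)
    show "flow_value T d F ` carrier_vec d \<subseteq> carrier_vec d"
      using flow_value_carrier T by auto
    fix x :: "real Matrix.vec" and \<epsilon> :: real assume x: "x \<in> carrier_vec d" and "\<epsilon> > 0"
    have "vdist d (flow_value T d F x) (flow_value T d F y) < \<epsilon>"
      if y: "y \<in> carrier_vec d" "vdist d x y < \<epsilon> / exp (L * T)" for y
    proof -
      have "vdist d (flow_value T d F x) (flow_value T d F y) \<le> exp (L * T) * vdist d x y"
        using flow_value_lipschitz[OF x y(1) T] flow_value_carrier[OF x T] flow_value_carrier[OF y(1) T] x y
        by (simp add: vdist_eq_vnorm)
      also have "\<dots> < exp (L * T) * (\<epsilon> / exp (L * T))"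
        using y(2) by (intro mult_strict_left_mono) auto
      finally show ?thesis by simp
    qed
    then show "\<exists>\<delta>>0. \<forall>y. y \<in> carrier_vec d \<and> vdist d x y < \<delta> \<longrightarrow>
        vdist d (flow_value T d F x) (flow_value T d F y) < \<epsilon>"
      using \<open>\<epsilon> > 0\<close> by (intro exI[of _ "\<epsilon> / exp (L * T)"]) auto
  qed
qed

lemma flow_op_C_fun:
  assumes G: "G \<in> C_fun d m" and T: "0 \<le> T"
  shows "(\<lambda>x. if x \<in> carrier_vec d then G (flow_value T d F x) else None) \<in> C_fun d m"
    (is "?P \<in> _")
proof -
  have "dom ?P = carrier_vec d"
    using G flow_value_carrier[OF _ T] by (auto simp: C_fun_iff dom_def)
  moreover have "continuous_map (Rn d) (Rn m) (\<lambda>x. the (G (flow_value T d F x)))"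
    using continuous_map_compose[OF flow_value_continuous[OF T]] G
    by (fastforce simp: C_fun_iff comp_def)
  then have "continuous_map (Rn d) (Rn m) (\<lambda>x. the (?P x))"
    by (rule continuous_map_eq) simp
  ultimately show ?thesis by (simp add: C_fun_iff)
qed

end

section \<open>A single network for the whole Euler scheme\<close>

lemma net_size_pos:
  assumes "is_net m n \<Phi>" "\<Phi> \<noteq> []"
  shows "1 \<le> net_size \<Phi>"
  using assms is_net_pos(1) by (cases \<Phi>) (auto simp: Suc_le_eq)

lemma euler_network_exists:
  assumes a: "continuous_on UNIV a"
    and \<Psi>: "\<Psi> \<in> ANNs" "layer_dims \<Psi> = [d, i, d]" "realization a \<Psi> = restrict_map Some (carrier_vec d)"
    and d: "1 \<le> d" and n: "0 < n"
    and \<Phi>: "\<Phi> \<in> ANNs" "realization a \<Phi> \<in> C_fun d d" "num_params \<Phi> \<le> p"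
    and \<Gamma>: "\<Gamma> \<in> ANNs" "realization a \<Gamma> \<in> C_fun d m" "num_params \<Gamma> \<le> p"
  shows "\<exists>\<Theta>\<in>ANNs. realization a \<Theta> \<in> C_fun d m \<and> num_params \<Theta> \<le> 3 * n * ((1 + i)\<^sup>2 * p)\<^sup>2 \<and>
    (\<forall>x\<in>carrier_vec d. the (realization a \<Theta> x) =
      net_eval a \<Gamma> (((\<lambda>y. y + h \<cdot>\<^sub>v net_eval a \<Phi> y) ^^ n) x))"
proof -
  obtain A b A' b' where "identity_network a d i A A' b b'"
    using identity_networkE[OF \<Psi>(1) d \<Psi>(2,3)] .
  then interpret identity_network a d i A A' b b' .
  note net\<Phi> = ANNs_realizationE[OF a \<Phi>(1,2)] and net\<Gamma> = ANNs_realizationE[OF a \<Gamma>(1,2)]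
  define \<Xi> where "\<Xi> = euler_net h (A, b) (A', b') \<Phi>"
  \<comment> \<open>A common bound for \<open>\<Gamma>\<close> and for the step network, which the
    identity branch enlarges by at most (1 + i)^2.\<close>
  define q where "q = (1 + i)\<^sup>2 * p"
  have \<Xi>: "is_net d d \<Xi>" "\<Xi> \<noteq> []"
    unfolding \<Xi>_def using euler_net[OF net\<Phi>] by blast+
  have "net_size \<Xi> \<le> (1 + i)\<^sup>2 * net_size \<Phi>"
    unfolding \<Xi>_def using euler_net[OF net\<Phi>] by blast
  also have "\<dots> \<le> q"
    unfolding q_def using \<Phi>(3) num_params_eq_net_size[OF net\<Phi>(1)] by (intro mult_left_mono) auto
  finally have size\<Xi>: "net_size \<Xi> \<le> q" .
  have "net_size \<Gamma> \<le> 1 * p" using \<Gamma>(3) num_params_eq_net_size[OF net\<Gamma>(1)] by simp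
  also have "\<dots> \<le> q" unfolding q_def by (intro mult_right_mono) auto
  finally have size\<Gamma>: "net_size \<Gamma> \<le> q" .
  then have q: "1 \<le> q" using net_size_pos[OF net\<Gamma>] by simp
  define \<Theta> where "\<Theta> = ((\<lambda>\<Psi>. net_comp \<Psi> \<Xi>) ^^ n) \<Gamma>"
  note \<Theta> = net_comp_iterate[OF \<Xi> size\<Xi> net\<Gamma> size\<Gamma>, where k = n, folded \<Theta>_def]
  have "q \<le> q * q" using q by simp
  then have "q + n * (q + q * q) \<le> n * (q * q) + n * (q * q + q * q)"
    using n by (intro add_mono mult_left_mono) (auto intro: order_trans[OF _ mult_le_mono1[of 1 n]])
  also have "\<dots> = 3 * n * q\<^sup>2" by (simp add: power2_eq_square algebra_simps)
  finally have "num_params \<Theta> \<le> 3 * n * q\<^sup>2"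
    using \<Theta>(3) num_params_eq_net_size[OF \<Theta>(1)] by simp
  moreover have "the (realization a \<Theta> x) = net_eval a \<Gamma> (((\<lambda>y. y + h \<cdot>\<^sub>v net_eval a \<Phi> y) ^^ n) x)"
    if x: "x \<in> carrier_vec d" for x
  proof -
    \<comment> \<open>\<open>\<Xi>\<close> is known to be the Euler step only on vectors of
      dimension \<open>d\<close>, so membership is part of the induction.\<close>
    have "(net_eval a \<Xi> ^^ k) x = ((\<lambda>y. y + h \<cdot>\<^sub>v net_eval a \<Phi> y) ^^ k) x \<and>
      (net_eval a \<Xi> ^^ k) x \<in> carrier_vec d" for k
    proof (induction k)
      case (Suc k)
      define y where "y = (net_eval a \<Xi> ^^ k) x"
      have y: "y = ((\<lambda>y. y + h \<cdot>\<^sub>v net_eval a \<Phi> y) ^^ k) x" "y \<in> carrier_vec d"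
        unfolding y_def using Suc by blast+
      have "net_eval a \<Xi> y = y + h \<cdot>\<^sub>v net_eval a \<Phi> y"
        unfolding \<Xi>_def by (rule euler_net(4)[OF net\<Phi> y(2)])
      moreover have "net_eval a \<Xi> y \<in> carrier_vec d"
        by (rule net_eval_carrier[OF \<Xi> y(2)])
      ultimately show ?case
        using y(1) by (simp add: y_def[symmetric])
    qed (use x in simp)
    then show ?thesis
      using realization_eq[OF \<Theta>(1,2) x] \<Theta>(4)[OF x, where a = a] by simp
  qed
  moreover have "\<Theta> \<in> ANNs" "realization a \<Theta> \<in> C_fun d m"
    using \<Theta>(1,2) realization_C_fun[OF a \<Theta>(1,2)] by (auto simp: ANNs_iff_is_net)
  ultimately show ?thesis unfolding q_def by blast
qed

text \<open>The dimensions hidden in the existential quantifiers of \<open>approx_space\<close> must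
  be those of \<open>f i\<close>, by uniqueness of the dimensions in \<open>C_fun\<close>; so they
  may be prescribed.\<close>

lemma approx_spaceE:
  assumes "f \<in> approx_space N r a w G H I \<dd>"
  obtains K :: real where "\<And>i \<epsilon> k l. \<lbrakk>i \<in> I; 0 < \<epsilon>; \<epsilon> \<le> 1; f i \<in> C_fun k l\<rbrakk> \<Longrightarrow>
    \<exists>\<Phi>\<in>ANNs. realization a \<Phi> \<in> C_fun k l \<and>
      real (num_params \<Phi>) \<le> K * \<epsilon> powr (- r 0) * (\<Prod>l = 1..N. real (\<dd> i l) powr r l) \<and>
      (\<forall>x\<in>carrier_vec k.
        w (vnorm x) * vnorm (the (f i x) - the (realization a \<Phi> x)) \<le> \<epsilon> \<and>
        ereal (vnorm (the (realization a \<Phi> x))) \<le> G i \<epsilon> * (H i \<epsilon> + ereal (vnorm x)))"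
proof -
  from assms obtain K where K: "\<And>i \<epsilon>. \<lbrakk>i \<in> I; \<epsilon> \<in> {0<..1}\<rbrakk> \<Longrightarrow> \<exists>\<Phi>\<in>ANNs. \<exists>m\<ge>1. \<exists>n\<ge>1. \<forall>x\<in>carrier_vec m.
      {f i, realization a \<Phi>} \<subseteq> C_fun m n \<and>
      real (num_params \<Phi>) \<le> K * \<epsilon> powr (- r 0) * (\<Prod>l = 1..N. real (\<dd> i l) powr r l) \<and>
      w (vnorm x) * vnorm (the (f i x) - the (realization a \<Phi> x)) \<le> \<epsilon> \<and>
      ereal (vnorm (the (realization a \<Phi> x))) \<le> G i \<epsilon> * (H i \<epsilon> + ereal (vnorm x))"
    unfolding approx_space_def by blast
  show thesis
  proof (rule that[of K])
    fix i and \<epsilon> :: real and k l assume i: "i \<in> I" and \<epsilon>: "0 < \<epsilon>" "\<epsilon> \<le> 1" and f: "f i \<in> C_fun k l"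
    then obtain \<Phi> m n where \<Phi>: "\<Phi> \<in> ANNs" and *: "\<And>x. x \<in> carrier_vec m \<Longrightarrow>
      {f i, realization a \<Phi>} \<subseteq> C_fun m n \<and>
      real (num_params \<Phi>) \<le> K * \<epsilon> powr (- r 0) * (\<Prod>l = 1..N. real (\<dd> i l) powr r l) \<and>
      w (vnorm x) * vnorm (the (f i x) - the (realization a \<Phi> x)) \<le> \<epsilon> \<and>
      ereal (vnorm (the (realization a \<Phi> x))) \<le> G i \<epsilon> * (H i \<epsilon> + ereal (vnorm x))"
      using K[of i \<epsilon>] by auto
    \<comment> \<open>The conditions that do not involve x stand under the quantifier over x; the
      zero vector extracts them.\<close>
    have "m = k" "n = l"
      using C_fun_unique_dims[OF f] *[OF zero_carrier_vec] by auto
    then show "\<exists>\<Phi>\<in>ANNs. realization a \<Phi> \<in> C_fun k l \<and>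
      real (num_params \<Phi>) \<le> K * \<epsilon> powr (- r 0) * (\<Prod>l = 1..N. real (\<dd> i l) powr r l) \<and>
      (\<forall>x\<in>carrier_vec k.
        w (vnorm x) * vnorm (the (f i x) - the (realization a \<Phi> x)) \<le> \<epsilon> \<and>
        ereal (vnorm (the (realization a \<Phi> x))) \<le> G i \<epsilon> * (H i \<epsilon> + ereal (vnorm x)))"
      using \<Phi> * *[OF zero_carrier_vec] by blast
  qed
qed

text \<open>An infinite \<open>h\<close> would make the first summand infinite. So \<open>h\<close>
  is real, and as all summands are nonnegative each of them is bounded by \<open>B\<close>
  separately.\<close>

lemma ereal_sum_bound_cases:
  fixes u v y B :: real
  assumes "ereal_powr h \<kappa> / ereal u + ereal v + ereal y \<le> ereal B"
    and "0 < h" "0 < u" "0 \<le> v" "0 \<le> y"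
  obtains k where "h = ereal k" "0 < k" "k powr \<kappa> \<le> B * u" "v \<le> B" "y \<le> B"
proof (cases h)
  case (real k)
  then have "ereal (k powr \<kappa> / u + v + y) \<le> ereal B"
    using assms(1,3) by (simp add: ereal_powr_def)
  then have le: "k powr \<kappa> / u + v + y \<le> B" by simp
  moreover have "0 \<le> k powr \<kappa> / u" using assms by simp
  ultimately have "k powr \<kappa> / u \<le> B" "v \<le> B" "y \<le> B" using assms by linarith+
  then show thesis
    using that[of k] real assms by (simp add: divide_simps)
next
  case PInf
  then show thesis using assms by (simp add: ereal_powr_def)
qed (use assms in simp)

text \<open>Taking the exponent family \<open>s\<close> as an argument reduces products, powers and
  comparisons of such monomials to pointwise arithmetic of exponents.\<close>

definition dim_prod :: "nat \<Rightarrow> (nat \<Rightarrow> nat) \<Rightarrow> (nat \<Rightarrow> real) \<Rightarrow> real" where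
  "dim_prod N v s = (\<Prod>l = 1..N. real (v l) powr s l)"

context
  fixes N :: nat and v :: "nat \<Rightarrow> nat"
  assumes v: "\<forall>l\<in>{1..N}. 1 \<le> v l"
begin

lemma dim_prod_pos: "0 < dim_prod N v s"
  unfolding dim_prod_def using v by (intro prod_pos) (auto simp: Suc_le_eq)

lemma dim_prod_mono: "(\<And>l. l \<in> {1..N} \<Longrightarrow> s l \<le> t l) \<Longrightarrow> dim_prod N v s \<le> dim_prod N v t"
  unfolding dim_prod_def using v by (intro prod_mono) (auto intro!: powr_mono)

lemma dim_prod_ge_1: "(\<And>l. l \<in> {1..N} \<Longrightarrow> 0 \<le> s l) \<Longrightarrow> 1 \<le> dim_prod N v s"
proof -
  have "dim_prod N v (\<lambda>_. 0) = 1"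
    unfolding dim_prod_def using v by (intro prod.neutral) auto
  moreover assume "\<And>l. l \<in> {1..N} \<Longrightarrow> 0 \<le> s l"
  ultimately show ?thesis using dim_prod_mono[of "\<lambda>_. 0" s] by simp
qed

lemma dim_prod_mult: "dim_prod N v s * dim_prod N v t = dim_prod N v (\<lambda>l. s l + t l)"
  unfolding dim_prod_def by (simp add: powr_add flip: prod.distrib)

lemma dim_prod_powr: "dim_prod N v s powr e = dim_prod N v (\<lambda>l. e * s l)"
  unfolding dim_prod_def by (simp add: prod_powr_distrib powr_powr mult.commute)

lemma dim_prod_power: "dim_prod N v s ^ k = dim_prod N v (\<lambda>l. real k * s l)"
  using dim_prod_powr[of s "real k"] dim_prod_pos[of s] by (simp add: powr_realpow)

end

section \<open>Choice of the parameters and comparison of the exponents\<close>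

theorem theorem4p6:
  fixes N :: nat
    and I :: "'i set"
    and \<dd> :: "'i \<Rightarrow> nat \<Rightarrow> nat"
    and c T \<rho> \<kappa> :: real
    and r \<alpha> \<beta> \<iota> R :: "nat \<Rightarrow> real"
    and H :: "'i \<Rightarrow> real \<Rightarrow> ereal"
    and a w :: "real \<Rightarrow> real"
    and \<ii> :: "nat \<Rightarrow> nat"
    and \<Psi> :: "nat \<Rightarrow> ann"
    and \<II> :: "'i \<Rightarrow> nat"
    and f g :: "'i \<Rightarrow> vfun"
  assumes "1 \<le> N"
    and "I \<noteq> {}"
    and "dimension_mapping N I \<dd>"
    and "0 \<le> c" and "0 \<le> T"
    and "\<forall>k\<in>{0..N}. 0 \<le> r k \<and> 0 \<le> R k"
    and "\<forall>k\<in>{1..N}. 0 \<le> \<alpha> k \<and> 0 \<le> \<beta> k \<and> 0 \<le> \<iota> k"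
    and "0 \<le> \<rho>" and "\<rho> < 1"
    and "1 \<le> \<kappa>"
    and "\<forall>i\<in>I. \<forall>\<epsilon>\<in>{0<..1}. 0 < H i \<epsilon>"
    and "continuous_on UNIV a"
    and "\<forall>d\<ge>1. 1 \<le> \<ii> d"
    and "\<forall>d\<ge>1. \<Psi> d \<in> ANNs"
    and "R 0 = 1 + 2 * r 0 * (\<kappa> + 2) / (1 - \<rho>)"
    and "\<forall>k\<in>{1..N}. R k = \<alpha> k + 2 * r k + 8 * \<iota> k
           + 2 * r 0 * (\<alpha> k * (\<kappa> + 1) + \<beta> k) / (1 - \<rho>)"
    and "\<forall>d\<ge>1. realization a (\<Psi> d) = restrict_map Some (carrier_vec d)"
    and "\<forall>d\<ge>1. layer_dims (\<Psi> d) = [d, \<ii> d, d]"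
    and "\<forall>d\<ge>1. real (\<ii> d) \<le> c * real d"
    and "\<forall>i\<in>I. 1 \<le> \<II> i"
    and "\<forall>v\<ge>0. w v = inverse (1 + v powr \<kappa>)"
    and "f \<in> approx_space N r a w (\<lambda>i \<epsilon>. ereal c) H I \<dd>"
    and "g \<in> approx_space N r a w (\<lambda>i \<epsilon>. \<infinity>) (\<lambda>i \<epsilon>. \<infinity>) I \<dd>"
    and "\<forall>i\<in>I. f i \<in> C_fun (\<II> i) (\<II> i) \<and> g i \<in> C_fun (\<II> i) 1"
    and "\<forall>i\<in>I. \<forall>x\<in>carrier_vec (\<II> i). \<forall>y\<in>carrier_vec (\<II> i).
           max (vnorm (the (f i x) - the (f i y))) (vnorm (the (g i x) - the (g i y)))
             \<le> c * vnorm (x - y)"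
    and "(SUP j\<in>I. SUP \<epsilon>\<in>{0<..1}.
            ereal_powr (H j \<epsilon>) \<kappa> / ereal (\<epsilon> powr (- \<rho>) * (\<Prod>l = 1..N. real (\<dd> j l) powr \<beta> l))
            + ereal (vnorm (the (f j (0\<^sub>v (\<II> j)))) / (\<Prod>l = 1..N. real (\<dd> j l) powr \<alpha> l))
            + ereal (real (\<II> j) / (\<Prod>l = 1..N. real (\<dd> j l) powr \<iota> l))) < \<infinity>"
  shows "flow_op T \<II> g f \<in> approx_space N R a w (\<lambda>i \<epsilon>. \<infinity>) (\<lambda>i \<epsilon>. \<infinity>) I \<dd>"
proof -
  have dims: "\<forall>l\<in>{1..N}. 1 \<le> \<dd> i l" if "i \<in> I" for i
    using assms(3) that by (simp add: dimension_mapping_def)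
  note c = assms(4) and T = assms(5) and \<rho> = assms(8,9) and \<kappa> = assms(10) and a = assms(12)
  note dp_pos = dim_prod_pos[OF dims] and dp_mono = dim_prod_mono[OF dims]
    and dp_ge_1 = dim_prod_ge_1[OF dims] and dp_mult = dim_prod_mult[OF dims]
    and dp_power = dim_prod_power[OF dims] and dp_powr = dim_prod_powr[OF dims]
  let ?D = "\<lambda>i. dim_prod N (\<dd> i)"
  have w: "w (vnorm x) = inverse (1 + vnorm x powr \<kappa>)" for x
    using assms(21) by simp
  have w_le: "b \<le> \<epsilon> * (1 + vnorm x powr \<kappa>)" if "w (vnorm x) * b \<le> \<epsilon>" for x b \<epsilon>
    using that by (simp add: w field_simps add_pos_nonneg)
  have w_le': "w (vnorm x) * b \<le> \<epsilon>" if "b \<le> \<epsilon> * (1 + vnorm x powr \<kappa>)" for x b \<epsilon>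
    using that by (simp add: w field_simps add_pos_nonneg)
  have field: "lipschitz_field (\<II> i) (f i) c" if i: "i \<in> I" for i
    using assms(24,25) c i by unfold_locales (auto dest!: bspec)
  have C_fun: "flow_op T \<II> g f i \<in> C_fun (\<II> i) 1" if i: "i \<in> I" for i
    unfolding flow_op_def using lipschitz_field.flow_op_C_fun[OF field[OF i] _ T] assms(24) i by blast
  obtain Sr :: real where Sr: "\<And>j \<epsilon>. \<lbrakk>j \<in> I; \<epsilon> \<in> {0<..1}\<rbrakk> \<Longrightarrow>
    ereal_powr (H j \<epsilon>) \<kappa> / ereal (\<epsilon> powr (- \<rho>) * ?D j \<beta>)
      + ereal (vnorm (the (f j (0\<^sub>v (\<II> j)))) / ?D j \<alpha>)
      + ereal (real (\<II> j) / ?D j \<iota>) \<le> ereal Sr"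
  proof -
    let ?s = "\<lambda>j \<epsilon>. ereal_powr (H j \<epsilon>) \<kappa> / ereal (\<epsilon> powr (- \<rho>) * ?D j \<beta>)
      + ereal (vnorm (the (f j (0\<^sub>v (\<II> j)))) / ?D j \<alpha>)
      + ereal (real (\<II> j) / ?D j \<iota>)"
    have "(SUP j\<in>I. SUP \<epsilon>\<in>{0<..1}. ?s j \<epsilon>) < \<infinity>"
      using assms(26) by (simp add: dim_prod_def)
    from ereal_dense2[OF this] obtain Sr where Sr: "(SUP j\<in>I. SUP \<epsilon>\<in>{0<..1}. ?s j \<epsilon>) < ereal Sr"
      by blast
    have "?s j \<epsilon> \<le> (SUP j\<in>I. SUP \<epsilon>\<in>{0<..1}. ?s j \<epsilon>)" if "j \<in> I" "\<epsilon> \<in> {0<..1}" for j \<epsilon>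
      by (rule SUP_upper2[OF that(1)], rule SUP_upper[OF that(2)])
    then have "?s j \<epsilon> \<le> ereal Sr" if "j \<in> I" "\<epsilon> \<in> {0<..1}" for j \<epsilon>
      using that Sr by (meson less_imp_le order_trans)
    then show thesis by (rule that)
  qed
  \<comment> \<open>Raised to at least 1, as \<open>flow_error_bound\<close> demands.\<close>
  define S where "S = max 1 Sr"
  have S1: "1 \<le> S" by (simp add: S_def)
  have S: "\<exists>k>0. H i \<epsilon> = ereal k \<and> k powr \<kappa> \<le> S * (\<epsilon> powr (- \<rho>) * ?D i \<beta>)"
    "vnorm (the (f i (0\<^sub>v (\<II> i)))) \<le> S * ?D i \<alpha>" "real (\<II> i) \<le> S * ?D i \<iota>"
    if i: "i \<in> I" and \<epsilon>: "0 < \<epsilon>" "\<epsilon> \<le> 1" for i \<epsilon>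
  proof -
    have "0 < H i \<epsilon>" using assms(11) i \<epsilon> by auto
    then obtain k where k: "H i \<epsilon> = ereal k" "0 < k"
      "k powr \<kappa> \<le> Sr * (\<epsilon> powr (- \<rho>) * ?D i \<beta>)"
      "vnorm (the (f i (0\<^sub>v (\<II> i)))) / ?D i \<alpha> \<le> Sr" "real (\<II> i) / ?D i \<iota> \<le> Sr"
      using ereal_sum_bound_cases[OF Sr[OF i, of \<epsilon>]] \<epsilon> dp_pos[OF i] by (auto simp: less_imp_le)
    have "Sr \<le> S" by (simp add: S_def)
    have le: "Sr * b \<le> S * b" if "0 < b" for b
      using \<open>Sr \<le> S\<close> that by (intro mult_right_mono) auto
    show "\<exists>k>0. H i \<epsilon> = ereal k \<and> k powr \<kappa> \<le> S * (\<epsilon> powr (- \<rho>) * ?D i \<beta>)"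
      using k(1,2) order_trans[OF k(3) le[of "\<epsilon> powr (- \<rho>) * ?D i \<beta>"]] \<epsilon> dp_pos[OF i]
      by (intro exI[of _ k]) auto
    show "vnorm (the (f i (0\<^sub>v (\<II> i)))) \<le> S * ?D i \<alpha>" "real (\<II> i) \<le> S * ?D i \<iota>"
      using k(4,5) order_trans[OF _ le[of "?D i \<alpha>"]] order_trans[OF _ le[of "?D i \<iota>"]] dp_pos[OF i]
      by (simp_all add: pos_divide_le_eq)
  qed
  obtain Kf where Kf: "\<And>i \<epsilon> k l. \<lbrakk>i \<in> I; 0 < \<epsilon>; \<epsilon> \<le> 1; f i \<in> C_fun k l\<rbrakk> \<Longrightarrow>
    \<exists>\<Phi>\<in>ANNs. realization a \<Phi> \<in> C_fun k l \<and>
      real (num_params \<Phi>) \<le> Kf * \<epsilon> powr (- r 0) * ?D i r \<and>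
      (\<forall>x\<in>carrier_vec k.
        w (vnorm x) * vnorm (the (f i x) - the (realization a \<Phi> x)) \<le> \<epsilon> \<and>
        ereal (vnorm (the (realization a \<Phi> x))) \<le> ereal c * (H i \<epsilon> + ereal (vnorm x)))"
    unfolding dim_prod_def using approx_spaceE[OF assms(22)] by blast
  obtain Kg where Kg: "\<And>i \<epsilon> k l. \<lbrakk>i \<in> I; 0 < \<epsilon>; \<epsilon> \<le> 1; g i \<in> C_fun k l\<rbrakk> \<Longrightarrow>
    \<exists>\<Phi>\<in>ANNs. realization a \<Phi> \<in> C_fun k l \<and>
      real (num_params \<Phi>) \<le> Kg * \<epsilon> powr (- r 0) * ?D i r \<and>
      (\<forall>x\<in>carrier_vec k.
        w (vnorm x) * vnorm (the (g i x) - the (realization a \<Phi> x)) \<le> \<epsilon> \<and>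
        ereal (vnorm (the (realization a \<Phi> x))) \<le> \<infinity> * (\<infinity> + ereal (vnorm x)))"
    unfolding dim_prod_def using approx_spaceE[OF assms(23)] by blast
  define K where "K = max 1 (max Kf Kg)"
  define E where "E = exp (c * T)"
  \<comment> \<open>\<open>C2\<close> and \<open>C3\<close> are the coefficients in
    \<open>flow_error_bound\<close> for the Lipschitz constant \<open>c\<close>. Then
    \<open>M\<close> and \<open>M'\<close> make the two contributions at most \<epsilon>/2 each,
    \<open>e\<close> inverts the power 1 - \<rho>, and the factors of \<open>K'\<close> come from
    the number of steps, the width of the identity network and the size of the single
    networks.\<close>
  define C2 where "C2 = 2 * (c * T * E) * c * (S * (1 + c * T * E) + c * E)"
  define C3 where "C3 = (c * T * E + 1) * (1 + (2 * E) powr \<kappa> * S)"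
  define M where "M = max 1 (2 * C2 * T)"
  define M' where "M' = max 1 (2 * C3)"
  define e where "e = 1 / (1 - \<rho>)"
  define K' where "K' = 3 * (2 * M) * ((2 * c * S) ^ 4 * (K * M' powr (e * r 0))\<^sup>2)"
  have E1: "1 \<le> E" using c T by (simp add: E_def)
  have M1: "1 \<le> M" "2 * C2 * T \<le> M" and M'1: "1 \<le> M'" "2 * C3 \<le> M'"
    by (auto simp: M_def M'_def)
  have e: "0 < e" "e * (1 - \<rho>) = 1" using \<rho> by (auto simp: e_def)
  have K1: "1 \<le> K" "Kf \<le> K" "Kg \<le> K" by (auto simp: K_def)
  \<comment> \<open>From dimension 1, where the hidden width is at least 1 and at most
    \<open>c\<close>.\<close>
  have c1: "1 \<le> c" using assms(13,19) by (auto dest!: spec[of _ 1])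
  have r0: "0 \<le> r 0" using assms(6) by auto
  have D\<alpha>: "1 \<le> ?D i \<alpha>" and D\<beta>: "1 \<le> ?D i \<beta>" and D\<iota>: "1 \<le> ?D i \<iota>" if "i \<in> I" for i
    using assms(7) by (auto intro!: dp_ge_1[OF that])
  have main: "\<exists>\<Phi>\<in>ANNs. realization a \<Phi> \<in> C_fun (\<II> i) 1 \<and>
      real (num_params \<Phi>) \<le> K' * \<epsilon> powr (- R 0) * ?D i R \<and>
      (\<forall>x\<in>carrier_vec (\<II> i).
        vnorm (the (flow_op T \<II> g f i x) - the (realization a \<Phi> x)) \<le> \<epsilon> * (1 + vnorm x powr \<kappa>))"
    if i: "i \<in> I" and \<epsilon>: "0 < \<epsilon>" "\<epsilon> \<le> 1" for i \<epsilon>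
  proof -
    interpret lipschitz_field "\<II> i" "f i" c by (rule field[OF i])
    define d where "d = \<II> i"
    have d: "1 \<le> d" using assms(20) i by (simp add: d_def)
    have fi: "f i \<in> C_fun d d" and gi: "g i \<in> C_fun d 1" using assms(24) i by (auto simp: d_def)
    \<comment> \<open>The solution of \<delta>^(1-\<rho>) D^\<beta> = \<epsilon> / M'. The
      denominator is at least 1, which keeps \<delta> in (0, 1].\<close>
    define \<delta> where "\<delta> = (\<epsilon> / (M' * ?D i \<beta>)) powr e"
    define n where "n = nat \<lceil>M * ?D i \<alpha> / \<epsilon>\<rceil>"
    define h where "h = T / real n"
    have M'D: "1 \<le> M' * ?D i \<beta>" using M'1(1) D\<beta>[OF i] mult_mono[of 1 M' 1 "?D i \<beta>"] by simp
    then have "\<epsilon> / (M' * ?D i \<beta>) \<le> 1" "0 < \<epsilon> / (M' * ?D i \<beta>)"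
      using \<epsilon> by (auto simp: divide_simps)
    then have \<delta>: "0 < \<delta>" "\<delta> \<le> 1" using e powr_mono2[of e "\<epsilon> / (M' * ?D i \<beta>)" 1] by (auto simp: \<delta>_def)
    have \<delta>_powr: "\<delta> powr (1 - \<rho>) * ?D i \<beta> = \<epsilon> / M'"
    proof -
      have "\<delta> powr (1 - \<rho>) = \<epsilon> / (M' * ?D i \<beta>)"
        using less_imp_le[OF \<open>0 < \<epsilon> / (M' * ?D i \<beta>)\<close>] by (simp only: \<delta>_def powr_powr e(2) powr_one)
      then show ?thesis using dp_pos[OF i, of \<beta>] by simp
    qed
    have "1 \<le> M * ?D i \<alpha>" using M1(1) D\<alpha>[OF i] mult_mono[of 1 M 1 "?D i \<alpha>"] by simp
    then have MD: "1 \<le> M * ?D i \<alpha> / \<epsilon>" using \<epsilon> by (simp add: divide_simps)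
    have n_ge: "M * ?D i \<alpha> / \<epsilon> \<le> real n" unfolding n_def by (rule real_nat_ceiling_ge)
    \<comment> \<open>Rounding up adds at most 1, which is absorbed because the rounded number is at
      least 1.\<close>
    have n_le: "real n \<le> 2 * M * ?D i \<alpha> / \<epsilon>" using MD unfolding n_def by linarith
    have n: "0 < n" using n_ge MD by (auto intro: ccontr)
    obtain \<Phi> where \<Phi>: "\<Phi> \<in> ANNs" "realization a \<Phi> \<in> C_fun d d"
      "real (num_params \<Phi>) \<le> Kf * \<delta> powr (- r 0) * ?D i r"
      "\<And>x. x \<in> carrier_vec d \<Longrightarrow> w (vnorm x) * vnorm (the (f i x) - the (realization a \<Phi> x)) \<le> \<delta>"
      "\<And>x. x \<in> carrier_vec d \<Longrightarrow> ereal (vnorm (the (realization a \<Phi> x))) \<le> ereal c * (H i \<delta> + ereal (vnorm x))"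
      using Kf[OF i \<delta> fi] by blast
    obtain \<Gamma> where \<Gamma>: "\<Gamma> \<in> ANNs" "realization a \<Gamma> \<in> C_fun d 1"
      "real (num_params \<Gamma>) \<le> Kg * \<delta> powr (- r 0) * ?D i r"
      "\<And>x. x \<in> carrier_vec d \<Longrightarrow> w (vnorm x) * vnorm (the (g i x) - the (realization a \<Gamma> x)) \<le> \<delta>"
      using Kg[OF i \<delta> gi] by blast
    note net\<Phi> = ANNs_realizationE[OF a \<Phi>(1,2)] and net\<Gamma> = ANNs_realizationE[OF a \<Gamma>(1,2)]
    define p where "p = max (num_params \<Phi>) (num_params \<Gamma>)"
    obtain \<Theta> where \<Theta>: "\<Theta> \<in> ANNs" "realization a \<Theta> \<in> C_fun d 1"
      "num_params \<Theta> \<le> 3 * n * ((1 + \<ii> d)\<^sup>2 * p)\<^sup>2"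
      "\<And>x. x \<in> carrier_vec d \<Longrightarrow> the (realization a \<Theta> x) =
        net_eval a \<Gamma> (((\<lambda>y. y + h \<cdot>\<^sub>v net_eval a \<Phi> y) ^^ n) x)"
      using euler_network_exists[OF a _ _ _ d n \<Phi>(1,2) _ \<Gamma>(1,2), of "\<Psi> d" "\<ii> d" p h]
        assms(14,17,18) d by (auto simp: p_def)
    \<comment> \<open>The growth parameter is taken at the accuracy \<delta> of the network, so its
      bound carries \<delta>^(-\<rho>) and not a power of \<epsilon>.\<close>
    obtain k where k: "H i \<delta> = ereal k" "0 < k" "k powr \<kappa> \<le> S * (\<delta> powr (- \<rho>) * ?D i \<beta>)"
      using S(1)[OF i \<delta>] by blast
    have err: "vnorm (the (flow_op T \<II> g f i x) - the (realization a \<Theta> x)) \<le> \<epsilon> * (1 + vnorm x powr \<kappa>)"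
      if x: "x \<in> carrier_vec d" for x
    proof -
      define f0 where "f0 = vnorm (the (f i (0\<^sub>v d)))"
      have "the (flow_op T \<II> g f i x) = the (g i (flow_value T d (f i) x))"
        using x by (simp add: flow_op_def d_def)
      then have "vnorm (the (flow_op T \<II> g f i x) - the (realization a \<Theta> x)) =
          vnorm (the (g i (flow_value T d (f i) x)) -
            net_eval a \<Gamma> (((\<lambda>y. y + h \<cdot>\<^sub>v net_eval a \<Phi> y) ^^ n) x))"
        using \<Theta>(4)[OF x] by simp
      also have "\<dots> \<le> c * T * E * (c * h * (f0 + c * ((vnorm x + T * f0) * E))) +
          (c * T * E + 1) * (\<delta> * (1 + (E * (vnorm x + k)) powr \<kappa>))"
        unfolding h_def E_def f0_def d_def
      proof (rule flow_approx_error[where m = 1])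
        fix y z :: "real Matrix.vec" assume y: "y \<in> carrier_vec (\<II> i)" and z: "z \<in> carrier_vec (\<II> i)"
        show "vnorm (the (g i y) - the (g i z)) \<le> c * vnorm (y - z)"
          using assms(25) i y z by (auto dest!: bspec)
      next
        fix y :: "real Matrix.vec" assume "y \<in> carrier_vec (\<II> i)"
        then have y: "y \<in> carrier_vec d" by (simp add: d_def)
        note eq = realization_eq[OF net\<Phi> y, of a] realization_eq[OF net\<Gamma> y, of a]
        show "net_eval a \<Phi> y \<in> carrier_vec (\<II> i)" "net_eval a \<Gamma> y \<in> carrier_vec 1"
          "the (g i y) \<in> carrier_vec 1"
          using net_eval_carrier[OF net\<Phi> y] net_eval_carrier[OF net\<Gamma> y] C_fun_carrier[OF gi y]
          by (simp_all add: d_def)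
        show "vnorm (net_eval a \<Phi> y) \<le> c * (k + vnorm y)"
          using \<Phi>(5)[OF y] by (simp add: eq k(1))
        show "vnorm (the (f i y) - net_eval a \<Phi> y) \<le> \<delta> * (1 + vnorm y powr \<kappa>)"
          "vnorm (the (g i y) - net_eval a \<Gamma> y) \<le> \<delta> * (1 + vnorm y powr \<kappa>)"
          using w_le[OF \<Phi>(4)[OF y]] w_le[OF \<Gamma>(4)[OF y]] by (simp_all add: eq)
      qed (use x T n k \<kappa> \<delta> d_def in auto)
      also have "\<dots> \<le> (C2 * (h * ?D i \<alpha>) + C3 * (\<delta> powr (1 - \<rho>) * ?D i \<beta>)) * (1 + vnorm x powr \<kappa>)"
        unfolding C2_def C3_def
        using c T k E1 S1 D\<alpha>[OF i] D\<beta>[OF i] \<kappa> \<delta> \<rho> S(2)[OF i \<epsilon>]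
        by (intro flow_error_bound) (auto simp: f0_def d_def h_def)
      also have "\<dots> \<le> \<epsilon> * (1 + vnorm x powr \<kappa>)"
      proof (rule mult_right_mono)
        have "C2 * (h * ?D i \<alpha>) = C2 * T * ?D i \<alpha> / real n" by (simp add: h_def)
        also have "\<dots> \<le> (M / 2) * ?D i \<alpha> / real n"
          using M1(2) dp_pos[OF i, of \<alpha>] by (intro divide_right_mono mult_right_mono) auto
        also have "\<dots> \<le> \<epsilon> / 2"
          using n_ge n \<epsilon> by (simp add: divide_simps mult.commute)
        finally have 1: "C2 * (h * ?D i \<alpha>) \<le> \<epsilon> / 2" .
        have "C3 * (\<delta> powr (1 - \<rho>) * ?D i \<beta>) = C3 * \<epsilon> / M'" by (simp add: \<delta>_powr)
        also have "\<dots> \<le> (M' / 2) * \<epsilon> / M'"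
          using M'1 \<epsilon> by (intro divide_right_mono mult_right_mono) auto
        also have "\<dots> = \<epsilon> / 2" using M'1 by simp
        finally show "C2 * (h * ?D i \<alpha>) + C3 * (\<delta> powr (1 - \<rho>) * ?D i \<beta>) \<le> \<epsilon>"
          using 1 by simp
      qed (simp add: add_nonneg_nonneg)
      finally show ?thesis .
    qed
    define P where "P = K * \<delta> powr (- r 0) * ?D i r"
    have P: "real p \<le> P"
    proof -
      have "K2 * \<delta> powr (- r 0) * ?D i r \<le> P" if "K2 \<le> K" for K2
        unfolding P_def using that dp_pos[OF i, of r] by (intro mult_right_mono) auto
      from this[OF K1(2)] this[OF K1(3)] show ?thesis
        using \<Phi>(3) \<Gamma>(3) by (simp add: p_def)
    qed
    have "real (\<ii> d) \<le> c * (S * ?D i \<iota>)"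
      using assms(19) d mult_left_mono[OF S(3)[OF i \<epsilon>] c] by (force simp: d_def)
    \<comment> \<open>Absorbs the summand 1 of \<open>1 + \<ii> d\<close>.\<close>
    moreover have "1 \<le> c * (S * ?D i \<iota>)"
      using mult_mono[of 1 c 1 "S * ?D i \<iota>"] mult_mono[of 1 S 1 "?D i \<iota>"] c1 S1 D\<iota>[OF i] by simp
    ultimately have id: "1 + real (\<ii> d) \<le> 2 * c * S * ?D i \<iota>" by linarith
    have "real (num_params \<Theta>) \<le> 3 * real n * ((1 + real (\<ii> d))\<^sup>2 * real p)\<^sup>2"
      using \<Theta>(3) by (simp flip: of_nat_le_iff[where 'a = real])
    also have "\<dots> \<le> 3 * (2 * M * ?D i \<alpha> / \<epsilon>) * ((2 * c * S * ?D i \<iota>)\<^sup>2 * P)\<^sup>2"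
      using n_le id P by (intro mult_mono power_mono) auto
    \<comment> \<open>Inserting \<delta> trades the network accuracy for powers of \<epsilon> and of
      D^\<beta>, both with exponent r_0 / (1 - \<rho>) up to sign.\<close>
    also have "P = K * M' powr (e * r 0) * \<epsilon> powr (- (e * r 0)) * ?D i (\<lambda>l. r l + e * r 0 * \<beta> l)"
    proof -
      have "\<delta> powr (- r 0) = (\<epsilon> / (M' * ?D i \<beta>)) powr (- (e * r 0))"
        by (simp add: \<delta>_def powr_powr)
      also have "\<dots> = \<epsilon> powr (- (e * r 0)) * M' powr (e * r 0) * ?D i \<beta> powr (e * r 0)"
        using \<epsilon> M'1 dp_pos[OF i, of \<beta>] by (simp add: powr_divide powr_mult powr_minus field_simps)
      finally show ?thesis
        unfolding P_def dp_powr[OF i] using dp_mult[OF i, of r "\<lambda>l. e * r 0 * \<beta> l"]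
        by (simp add: ac_simps)
    qed
    \<comment> \<open>D^\<alpha> and one factor 1/\<epsilon> stem from the number of steps, the
      fourth power of D^\<iota> from squaring (1 + i)^2, and the remaining squares from the squared
      size of the single networks.\<close>
    also have "3 * (2 * M * ?D i \<alpha> / \<epsilon>) * ((2 * c * S * ?D i \<iota>)\<^sup>2 *
          (K * M' powr (e * r 0) * \<epsilon> powr (- (e * r 0)) * ?D i (\<lambda>l. r l + e * r 0 * \<beta> l)))\<^sup>2 =
        K' * (\<epsilon> powr (- 1) * (\<epsilon> powr (- (e * r 0)))\<^sup>2) *
          (?D i \<alpha> * ?D i \<iota> ^ 4 * (?D i (\<lambda>l. r l + e * r 0 * \<beta> l))\<^sup>2)"
      using \<epsilon> by (simp add: K'_def power_mult_distrib powr_minus divide_simps flip: power_mult)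
    also have "\<epsilon> powr (- 1) * (\<epsilon> powr (- (e * r 0)))\<^sup>2 = \<epsilon> powr (- (1 + 2 * (e * r 0)))"
      by (simp only: power2_eq_square powr_add[symmetric]) simp
    also have "?D i \<alpha> * ?D i \<iota> ^ 4 * (?D i (\<lambda>l. r l + e * r 0 * \<beta> l))\<^sup>2 =
        ?D i (\<lambda>l. \<alpha> l + 4 * \<iota> l + 2 * (r l + e * r 0 * \<beta> l))"
      by (simp add: dp_power[OF i] dp_mult[OF i])
    \<comment> \<open>As \<epsilon> is at most 1 and the dimensions are at least 1, it remains to
      compare the exponents with \<open>R\<close>.\<close>
    also have "K' * \<epsilon> powr (- (1 + 2 * (e * r 0))) * ?D i (\<lambda>l. \<alpha> l + 4 * \<iota> l + 2 * (r l + e * r 0 * \<beta> l))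
        \<le> K' * \<epsilon> powr (- R 0) * ?D i R"
    proof (intro mult_mono order_refl)
      have "e * r 0 \<le> e * r 0 * (\<kappa> + 2)"
        using mult_left_mono[of 1 "\<kappa> + 2" "e * r 0"] e r0 \<kappa> by simp
      then have "1 + 2 * (e * r 0) \<le> R 0"
        using assms(15) by (simp add: e_def)
      then show "\<epsilon> powr (- (1 + 2 * (e * r 0))) \<le> \<epsilon> powr (- R 0)"
        using \<epsilon> by (intro powr_mono') auto
      show "?D i (\<lambda>l. \<alpha> l + 4 * \<iota> l + 2 * (r l + e * r 0 * \<beta> l)) \<le> ?D i R"
      proof (rule dp_mono[OF i])
        fix l assume l: "l \<in> {1..N}"
        then have nn: "0 \<le> \<alpha> l" "0 \<le> \<beta> l" "0 \<le> \<iota> l" using assms(7) by auto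
        have "R l = \<alpha> l + 2 * r l + 8 * \<iota> l + 2 * (e * r 0 * (\<alpha> l * (\<kappa> + 1) + \<beta> l))"
          using assms(16) l by (simp add: e_def)
        moreover have "e * r 0 * \<beta> l \<le> e * r 0 * (\<alpha> l * (\<kappa> + 1) + \<beta> l)"
          using e r0 nn \<kappa> by (intro mult_left_mono) auto
        ultimately show "\<alpha> l + 4 * \<iota> l + 2 * (r l + e * r 0 * \<beta> l) \<le> R l"
          using nn by simp
      qed
    qed (use M1 less_imp_le[OF dp_pos[OF i]] in \<open>auto simp: K'_def\<close>)
    finally show ?thesis
      using \<Theta>(1,2) err unfolding d_def by blast
  qed
  show ?thesis
    unfolding approx_space_def
  proof (intro CollectI conjI exI[of _ K'] ballI)
    show "flow_op T \<II> g f \<in> function_families I"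
      using C_fun assms(20) unfolding function_families_def by fastforce
    fix i and \<epsilon> :: real assume i: "i \<in> I" and "\<epsilon> \<in> {0<..1}"
    then have \<epsilon>: "0 < \<epsilon>" "\<epsilon> \<le> 1" by auto
    obtain \<Phi> where \<Phi>: "\<Phi> \<in> ANNs" "realization a \<Phi> \<in> C_fun (\<II> i) 1"
      "real (num_params \<Phi>) \<le> K' * \<epsilon> powr (- R 0) * ?D i R"
      "\<And>x. x \<in> carrier_vec (\<II> i) \<Longrightarrow>
        vnorm (the (flow_op T \<II> g f i x) - the (realization a \<Phi> x)) \<le> \<epsilon> * (1 + vnorm x powr \<kappa>)"
      using main[OF i \<epsilon>] by blast
    then show "\<exists>\<Phi>\<in>ANNs. \<exists>m\<ge>1. \<exists>n\<ge>1. \<forall>x\<in>carrier_vec m.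
        {flow_op T \<II> g f i, realization a \<Phi>} \<subseteq> C_fun m n \<and>
        real (num_params \<Phi>) \<le> K' * \<epsilon> powr (- R 0) * (\<Prod>l = 1..N. real (\<dd> i l) powr R l) \<and>
        w (vnorm x) * vnorm (the (flow_op T \<II> g f i x) - the (realization a \<Phi> x)) \<le> \<epsilon> \<and>
        ereal (vnorm (the (realization a \<Phi> x))) \<le> \<infinity> * (\<infinity> + ereal (vnorm x))"
      using C_fun[OF i] assms(20) i w_le'
      by (intro bexI[of _ \<Phi>] exI[of _ "\<II> i"] exI[of _ 1] conjI) (auto simp: dim_prod_def)
  qed
qed

end
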